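(* Let $D$ be a delta-matroid on $[n,\overline{n}]$ which has an enveloping matroid. Then the polynomial $$\sum_{S\text{ independent in }D}w_0^{2n-|S|}\,w^{\underline{S}}\in\mathbb{R}[w_0,w_1,\dots,w_n]$$ is Lorentzian.
   Context: Let $[n,\overline{n}]=\{1,\dots,n,\overline{1},\dots,\overline{n}\}$ with involution $a\mapsto\overline{a}$; $\overline{S}=\{\overline{a}:a\in S\}$. A subset is admissible if it contains at most one of $i,\overline{i}$ for each $i$; $\operatorname{AdS}_n$ is the set of admissible subsets. In $\mathbb{R}^n$ set $e_{\overline{i}}=-e_i$, $e_S=\sum_{a\in S}e_a$. A delta-matroid $D$ on $[n,\overline{n}]$ is a nonempty collection $\mathcal{F}$ of admissible sets of size $n$ (feasible sets) such that $P(D)=\operatorname{Conv}\{e_B:B\in\mathcal{F}\}$ has all edges parallel to some $e_i$ or $e_i\pm e_j$. An admissible set $S$ is independent in $D$ if it is contained in a feasible set (equivalently $\max_{B\in\mathcal{F}}(|S\cap B|-|\overline{S}\cap B|)=|S|$). For admissible $S$, $\underline{S}\subseteq[n]$ is its unsigned version (image under identifying $i$ with $\overline{i}$), and $w^T=\prod_{a\in T}w_a$. For $S\subseteq[n,\overline{n}]$ let $u_S\in\mathbb{R}^{[n,\overline{n}]}$ be its indicator vector; for a matroid $M$ on $[n,\overline{n}]$ let $P(M)=\operatorname{Conv}\{u_B:B\text{ a basis of }M\}$; let $\operatorname{env}(x_1,\dots,x_n,x_{\overline{1}},\dots,x_{\overline{n}})=(x_1-x_{\overline{1}},\dots,x_n-x_{\overline{n}})$.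 $M$ is an enveloping matroid for $D$ if $\operatorname{env}(P(M))=P(D)$. A homogeneous polynomial $f$ of degree $d$ with real coefficients is strictly Lorentzian if all its coefficients (of all degree-$d$ monomials) are positive and, for every choice of $d-2$ partial derivatives, the resulting quadratic form is nondegenerate with exactly one positive eigenvalue; $f$ is Lorentzian if it is a coefficient-wise limit of strictly Lorentzian polynomials. *)

theory Defs
  imports "HOL-Analysis.Analysis" "HOL-Computational_Algebra.Polynomial"
begin

text \<open>The ground set [n,nbar] is the type 'n \<times> bool with CARD('n) = n;
  (i, False) stands for i and (i, True) for its barred copy.\<close>

definition bar :: "'n \<times> bool \<Rightarrow> 'n \<times> bool" where
  "bar a = (fst a, \<not> snd a)"

definition admissible :: "('n \<times> bool) set \<Rightarrow> bool" where
  "admissible S \<longleftrightarrow> (\<forall>i. \<not> ((i, False) \<in> S \<and> (i, True) \<in> S))"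

definition evec :: "'n::finite \<times> bool \<Rightarrow> real^'n" where
  "evec a = (if snd a then - axis (fst a) 1 else axis (fst a) 1)"

definition eset :: "('n::finite \<times> bool) set \<Rightarrow> real^'n" where
  "eset S = (\<Sum>a\<in>S. evec a)"

definition delta_polytope :: "('n::finite \<times> bool) set set \<Rightarrow> (real^'n) set" where
  "delta_polytope F = convex hull (eset ` F)"

definition root_dir :: "real^'n::finite \<Rightarrow> bool" where
  "root_dir v \<longleftrightarrow> (\<exists>i j. v = axis i 1 \<or> v = axis i 1 + axis j 1 \<or> v = axis i 1 - axis j 1)"

definition edges_ok :: "(real^'n::finite) set \<Rightarrow> bool" where
  "edges_ok P \<longleftrightarrow> (\<forall>E. E face_of P \<and> aff_dim E = 1 \<longrightarrow>
      (\<exists>v. root_dir v \<and> (\<forall>x\<in>E. \<forall>y\<in>E. \<exists>c. y - x = c *\<^sub>R v)))"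

definition delta_matroid :: "('n::finite \<times> bool) set set \<Rightarrow> bool" where
  "delta_matroid F \<longleftrightarrow> F \<noteq> {} \<and>
     (\<forall>B\<in>F. admissible B \<and> card B = CARD('n)) \<and>
     edges_ok (delta_polytope F)"

definition independent_in :: "('n \<times> bool) set set \<Rightarrow> ('n \<times> bool) set \<Rightarrow> bool" where
  "independent_in F S \<longleftrightarrow> admissible S \<and> (\<exists>B\<in>F. S \<subseteq> B)"

definition matroid_bases :: "'a set \<Rightarrow> 'a set set \<Rightarrow> bool" where
  "matroid_bases E Bs \<longleftrightarrow> finite E \<and> Bs \<noteq> {} \<and> (\<forall>B\<in>Bs. B \<subseteq> E) \<and>
     (\<forall>B1\<in>Bs. \<forall>B2\<in>Bs. \<forall>x\<in>B1 - B2. \<exists>y\<in>B2 - B1. insert y (B1 - {x}) \<in> Bs)"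

definition uvec :: "('n::finite \<times> bool) set \<Rightarrow> real^('n \<times> bool)" where
  "uvec S = (\<chi> a. if a \<in> S then 1 else 0)"

definition matroid_polytope :: "('n::finite \<times> bool) set set \<Rightarrow> (real^('n \<times> bool)) set" where
  "matroid_polytope Bs = convex hull (uvec ` Bs)"

definition env :: "real^('n::finite \<times> bool) \<Rightarrow> real^'n" where
  "env x = (\<chi> i. x $ (i, False) - x $ (i, True))"

definition enveloping_matroid :: "('n::finite \<times> bool) set set \<Rightarrow> ('n \<times> bool) set set \<Rightarrow> bool" where
  "enveloping_matroid Bs F \<longleftrightarrow> matroid_bases UNIV Bs \<and>
     env ` matroid_polytope Bs = delta_polytope F"

text \<open>A real polynomial in variables indexed by the finite type 'v is represented by its
  coefficient function on monomials (exponent vectors 'v \<Rightarrow> nat).\<close>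
type_synonym 'v mpoly_coeffs = "('v \<Rightarrow> nat) \<Rightarrow> real"

definition mdeg :: "('v::finite \<Rightarrow> nat) \<Rightarrow> nat" where
  "mdeg \<alpha> = (\<Sum>v\<in>UNIV. \<alpha> v)"

definition homogeneous :: "nat \<Rightarrow> 'v::finite mpoly_coeffs \<Rightarrow> bool" where
  "homogeneous d f \<longleftrightarrow> (\<forall>\<alpha>. f \<alpha> \<noteq> 0 \<longrightarrow> mdeg \<alpha> = d)"

definition pdiff :: "'v \<Rightarrow> 'v mpoly_coeffs \<Rightarrow> 'v mpoly_coeffs" where
  "pdiff i f = (\<lambda>\<alpha>. real (\<alpha> i + 1) * f (\<alpha>(i := \<alpha> i + 1)))"

definition pdiffs :: "'v list \<Rightarrow> 'v mpoly_coeffs \<Rightarrow> 'v mpoly_coeffs" where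
  "pdiffs is f = foldr pdiff is f"

definition quad_matrix :: "'v::finite mpoly_coeffs \<Rightarrow> real^'v^'v" where
  "quad_matrix q = (\<chi> i j. pdiff i (pdiff j q) (\<lambda>_. 0))"

definition charpoly :: "real^'v::finite^'v \<Rightarrow> real poly" where
  "charpoly A = det (\<chi> i j. (if i = j then [:0, 1:] else 0) - [: A $ i $ j :])"

definition num_pos_eigenvalues :: "real^'v::finite^'v \<Rightarrow> nat" where
  "num_pos_eigenvalues A = (\<Sum>x\<in>{x. x > 0 \<and> poly (charpoly A) x = 0}. order x (charpoly A))"

definition strictly_lorentzian :: "nat \<Rightarrow> 'v::finite mpoly_coeffs \<Rightarrow> bool" where
  "strictly_lorentzian d f \<longleftrightarrow> homogeneous d f \<and>
     (\<forall>\<alpha>. mdeg \<alpha> = d \<longrightarrow> f \<alpha> > 0) \<and>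
     (\<forall>is. length is = d - 2 \<longrightarrow>
        det (quad_matrix (pdiffs is f)) \<noteq> 0 \<and>
        num_pos_eigenvalues (quad_matrix (pdiffs is f)) = 1)"

definition lorentzian :: "nat \<Rightarrow> 'v::finite mpoly_coeffs \<Rightarrow> bool" where
  "lorentzian d f \<longleftrightarrow> (\<exists>g. (\<forall>k. strictly_lorentzian d (g k)) \<and>
      (\<forall>\<alpha>. (\<lambda>k. g k \<alpha>) \<longlonglongrightarrow> f \<alpha>))"

text \<open>Variables: None is w_0, Some i is w_i. The monomial w_0^(2n-|S|) w^(unsigned S).\<close>
definition indep_monomial :: "('n::finite \<times> bool) set \<Rightarrow> 'n option \<Rightarrow> nat" where
  "indep_monomial S = (\<lambda>v. case v of None \<Rightarrow> 2 * CARD('n) - card S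
                                  | Some i \<Rightarrow> (if i \<in> fst ` S then 1 else 0))"

definition indep_poly :: "('n::finite \<times> bool) set set \<Rightarrow> 'n option mpoly_coeffs" where
  "indep_poly F = (\<lambda>\<alpha>. real (card {S. independent_in F S \<and> indep_monomial S = \<alpha>}))"

end

theory Submission
  imports Defs
begin

text \<open>
  Let \<open>M\<close> be an enveloping matroid. Comparing linear functionals on the two polytopes shows that an
  admissible set is independent in the delta-matroid iff it is independent in \<open>M\<close>. The polynomial
  \<open>\<Sum> w\<^sub>0 ^ (2n - |I|) * w ^ I\<close> over all independent sets of \<open>M\<close> has a polarization given by a simple
  recursion (contract an element or take \<open>w\<^sub>0\<close>). Its Alexandrov--Fenchel inequality is proved by
  induction: the quadratic case is the count of parallel classes, and the step is the Bochner argument, in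
  which the induction hypothesis gives \<open>A\<^sup>2 \<ge> A\<close> for a self-adjoint Markov operator \<open>A\<close>, so no
  eigenvalue of \<open>A\<close> lies strictly between 0 and 1. Evaluating the polarization at strictly positive
  vectors and damping the non-squarefree coefficients yields strictly Lorentzian polynomials. Letting
  the vectors tend to those identifying \<open>w\<^sub>i\<close> with its barred copy, and the damping factors of the
  variables other than \<open>w\<^sub>0\<close> tend to 0, leaves exactly the admissible independent sets.
\<close>

section \<open>Symmetric matrices with one positive eigenvalue\<close>

text \<open>On \<open>W\<close> the vector \<open>z\<close> minimizes the form, so its first
  variation in the direction \<open>w\<close>, which is twice \<open>p z w\<close>, must
  vanish.\<close>

lemma bilinear_psd_radical:
  fixes p :: "'a::real_vector \<Rightarrow> 'a \<Rightarrow> real"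
  assumes p: "bilinear p" and sym: "\<And>x y. p x y = p y x"
    and W: "subspace W" and psd: "\<And>w. w \<in> W \<Longrightarrow> p w w \<ge> 0"
    and z: "z \<in> W" "p z z = 0" and w: "w \<in> W"
  shows "p z w = 0"
proof (rule ccontr)
  assume "p z w \<noteq> 0"
  \<comment> \<open>Minimizes \<open>2 * t * p z w + t^2 * (p w w + 1)\<close>; the added 1 keeps
    the denominator positive when \<open>p w w = 0\<close>.\<close>
  define t where "t = - p z w / (p w w + 1)"
  have pw: "p w w \<ge> 0" by (rule psd[OF w])
  have "z + t *\<^sub>R w \<in> W" using W z w by (simp add: subspace_add subspace_scale)
  then have "0 \<le> p (z + t *\<^sub>R w) (z + t *\<^sub>R w)" by (rule psd)
  also have "\<dots> = 2 * t * p z w + t\<^sup>2 * p w w"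
    using z(2) sym[of w z]
    by (simp add: bilinear_ladd[OF p] bilinear_radd[OF p] bilinear_lmul[OF p] bilinear_rmul[OF p]
        power2_eq_square algebra_simps)
  also have "\<dots> \<le> 2 * t * p z w + t\<^sup>2 * (p w w + 1)"
    by (simp add: mult_left_mono)
  also have "\<dots> = - (p z w)\<^sup>2 / (p w w + 1)"
    using pw by (simp add: t_def power2_eq_square divide_simps)
  also have "\<dots> < 0" using \<open>p z w \<noteq> 0\<close> pw by (simp add: divide_neg_pos)
  finally show False by simp
qed

text \<open>The quotient of \<open>q\<close> by \<open>p\<close> attains its maximum
  \<open>l\<close> on the unit sphere of \<open>W\<close>. There \<open>l * p - q\<close> is
  positive semidefinite on \<open>W\<close> and null at the maximizer, so
  \<open>bilinear_psd_radical\<close> gives the eigenvector equation, tested against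
  \<open>W\<close> only.\<close>

lemma rayleigh_maximizer:
  fixes p q :: "'a::euclidean_space \<Rightarrow> 'a \<Rightarrow> real"
  assumes p: "bilinear p" and psym: "\<And>x y. p x y = p y x" and ppos: "\<And>x. x \<noteq> 0 \<Longrightarrow> p x x > 0"
    and q: "bilinear q" and qsym: "\<And>x y. q x y = q y x"
    and W: "subspace W" and W0: "w0 \<in> W" "w0 \<noteq> 0"
  obtains z l where "z \<in> W" "p z z = 1" "\<And>w. w \<in> W \<Longrightarrow> q w z = l * p w z"
    "\<And>w. w \<in> W \<Longrightarrow> q w w \<le> l * p w w"
proof -
  let ?S = "sphere 0 1 \<inter> W"
  have cont: "continuous_on A (\<lambda>x. f x x)" if "bilinear f" for A and f :: "'a \<Rightarrow> 'a \<Rightarrow> real"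
    using that bilinear_conv_bounded_bilinear[of f]
    by (intro bounded_bilinear.continuous_on[of f]) auto
  have "compact ?S" using W by (intro compact_Int_closed) (auto simp: closed_subspace)
  moreover have "w0 /\<^sub>R norm w0 \<in> ?S" using W W0 by (simp add: subspace_scale)
  moreover have "continuous_on ?S (\<lambda>x. q x x / p x x)"
  proof (intro continuous_on_divide cont[OF p] cont[OF q] ballI)
    fix x assume "x \<in> ?S"
    then have "x \<noteq> 0" by auto
    then show "p x x \<noteq> 0" using ppos[of x] by simp
  qed
  ultimately obtain z where z: "z \<in> ?S" and max: "\<And>y. y \<in> ?S \<Longrightarrow> q y y / p y y \<le> q z z / p z z"
    using continuous_attains_sup[of ?S "\<lambda>x. q x x / p x x"] by blast
  have z0: "z \<noteq> 0" using z by auto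
  have scale: "f (c *\<^sub>R x) (c *\<^sub>R x) = c\<^sup>2 * f x x" if "bilinear f"
    for c x and f :: "'a \<Rightarrow> 'a \<Rightarrow> real"
    using that by (simp add: bilinear_lmul bilinear_rmul power2_eq_square)
  define l where "l = q z z / p z z"
  have le: "q w w \<le> l * p w w" if w: "w \<in> W" for w
  proof (cases "w = 0")
    case True then show ?thesis using p q by (simp add: bilinear_lzero)
  next
    case False
    have "q (w /\<^sub>R norm w) (w /\<^sub>R norm w) / p (w /\<^sub>R norm w) (w /\<^sub>R norm w) \<le> l"
      unfolding l_def using W w False by (intro max) (simp add: subspace_scale)
    then have "q w w / p w w \<le> l" using False by (simp add: scale p q)
    then show ?thesis using ppos[OF False] by (simp add: divide_simps)
  qed
  have zW: "z \<in> W" using z by auto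
  define r where "r = (\<lambda>x y. l * p x y - q x y)"
  have r: "bilinear r"
    unfolding bilinear_def r_def
    by (auto intro!: linearI simp: bilinear_ladd[OF p] bilinear_radd[OF p] bilinear_lmul[OF p]
      bilinear_rmul[OF p] bilinear_ladd[OF q] bilinear_radd[OF q] bilinear_lmul[OF q]
      bilinear_rmul[OF q] algebra_simps)
  have rz: "r z z = 0" using ppos[OF z0] by (simp add: r_def l_def)
  have eq: "q w z = l * p w z" if w: "w \<in> W" for w
  proof -
    have "r x y = r y x" for x y unfolding r_def by (metis psym qsym)
    then have "r z w = 0"
      by (rule bilinear_psd_radical[OF r _ W _ zW rz w]) (simp add: r_def le)
    then show ?thesis by (simp add: r_def psym[of w] qsym[of w])
  qed
  let ?z = "(1 / sqrt (p z z)) *\<^sub>R z"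
  show thesis
  proof
    show "?z \<in> W" using W zW by (simp add: subspace_scale)
    show "p ?z ?z = 1" using ppos[OF z0] by (simp add: scale p power_divide)
    show "q w ?z = l * p w ?z" if "w \<in> W" for w
      using eq[OF that] by (simp add: bilinear_rmul[OF p] bilinear_rmul[OF q])
    show "q w w \<le> l * p w w" if "w \<in> W" for w by (rule le[OF that])
  qed
qed

section \<open>Characteristic polynomials and rank-one updates\<close>

lemma poly_det: "poly (det A) x = det (\<chi> i j. poly (A $ i $ j) x)"
  by (simp add: det_def poly_sum poly_prod)

lemma poly_charpoly: "poly (charpoly A) x = det (mat x - A)"
proof -
  have "(\<chi> i j. poly ((\<chi> i j. (if i = j then [:0, 1:] else 0) - [:A $ i $ j:]) $ i $ j) x) = mat x - A"
    by (auto simp: vec_eq_iff mat_def)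
  then show ?thesis by (simp add: charpoly_def poly_det)
qed

lemma det_eq_0_iff_kernel:
  fixes A :: "real^'n^'n"
  shows "det A = 0 \<longleftrightarrow> (\<exists>w. w \<noteq> 0 \<and> A *v w = 0)"
  using invertible_det_nz[of A] matrix_left_invertible_ker[of A] invertible_left_inverse[of A] by metis

lemma mat_minus_mult_vec:
  fixes A :: "real^'n^'n"
  shows "(mat x - A) *v w = x *\<^sub>R w - A *v w"
proof -
  have "(mat x :: real^'n^'n) *v w = x *\<^sub>R w"
    by (simp add: vec_eq_iff matrix_vector_mult_def mat_def if_distrib[of "\<lambda>u. u * _"] cong: if_cong)
  then show ?thesis by (simp add: matrix_vector_mult_diff_rdistrib)
qed

definition outer :: "real^'n \<Rightarrow> real^'n^'n" where
  "outer v = (\<chi> i j. v $ i * v $ j)"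

lemma outer_mult_vec: "outer v *v w = (v \<bullet> w) *\<^sub>R v"
  by (simp add: vec_eq_iff outer_def matrix_vector_mult_def inner_vec_def sum_distrib_left ac_simps)

text \<open>An orthogonal change of basis takes \<open>v\<close> to a coordinate vector, where the
  matrix is diagonal with one entry \<open>1 + c\<close> and all others 1.\<close>

lemma det_mat1_plus_outer:
  fixes v :: "real^'n"
  assumes "norm v = 1"
  shows "det (mat 1 + c *\<^sub>R outer v) = 1 + c"
proof -
  \<comment> \<open>Only names an arbitrary axis, which \<open>Q\<close> rotates onto
    \<open>v\<close>.\<close>
  obtain k :: 'n where True by auto
  obtain Q where Q: "orthogonal_matrix Q" "Q *v axis k 1 = v"
    using orthogonal_matrix_exists_basis[OF assms] by metis
  have QQ: "Q ** transpose Q = mat 1" "transpose Q ** Q = mat 1"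
    using Q(1) by (auto simp: orthogonal_matrix_def)
  let ?D = "mat 1 + c *\<^sub>R outer (axis k 1) :: real^'n^'n"
  have vv: "v \<bullet> (Q *v w) = axis k 1 \<bullet> w" for w
    by (metis QQ(2) Q(2) dot_lmul_matrix matrix_vector_mul_assoc matrix_vector_mul_lid transpose_matrix_vector)
  have "(mat 1 + c *\<^sub>R outer v) ** Q = Q ** ?D"
    unfolding matrix_eq
    by (simp add: matrix_vector_mul_assoc[symmetric] matrix_vector_mult_add_rdistrib
       matrix_vector_right_distrib scaleR_matrix_vector_assoc[symmetric] outer_mult_vec vv Q(2)
       vector_scalar_mult_def[symmetric] matrix_vector_mult_scaleR)
  then have "det (mat 1 + c *\<^sub>R outer v) * det Q = det Q * det ?D"
    by (metis det_mul)
  moreover have "det Q \<noteq> 0" using det_orthogonal_matrix[OF Q(1)] by auto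
  ultimately have "det (mat 1 + c *\<^sub>R outer v) = det ?D" by simp
  also have "\<dots> = (\<Prod>i\<in>UNIV. ?D $ i $ i)"
    by (rule det_diagonal) (auto simp: mat_def outer_def axis_def)
  also have "\<dots> = (\<Prod>i\<in>UNIV. if i = k then 1 + c else 1)"
    by (rule prod.cong) (auto simp: mat_def outer_def axis_def)
  also have "\<dots> = 1 + c" by simp
  finally show ?thesis .
qed

text \<open>The largest eigenvalue \<open>l\<close> is positive, and \<open>A\<close> is negative
  definite orthogonally to its eigenvector \<open>v\<close>, so every other eigenvalue is negative.
  The root \<open>l\<close> is simple because flipping it to \<open>-l\<close> by a rank-one update
  leaves no positive root.\<close>

lemma hyperbolic_matrix_eigenvalues:
  fixes A :: "real^'n^'n"
  assumes sym: "transpose A = A"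
    and pos: "u \<bullet> (A *v u) > 0"
    and neg: "\<And>y. c \<bullet> y = 0 \<Longrightarrow> y \<noteq> 0 \<Longrightarrow> y \<bullet> (A *v y) < 0"
  shows "det A \<noteq> 0" and "num_pos_eigenvalues A = 1"
proof -
  define q where "q = (\<lambda>x y. x \<bullet> (A *v y))"
  have qb: "bilinear q"
    unfolding q_def bilinear_def
    by (auto intro!: linearI simp: inner_left_distrib inner_right_distrib
       matrix_vector_right_distrib matrix_vector_mult_scaleR)
  have qs: "q x y = q y x" for x y
    unfolding q_def by (metis dot_lmul_matrix inner_commute sym transpose_matrix_vector)
  have ib: "bilinear (inner :: real^'n \<Rightarrow> _)"
    unfolding bilinear_def by (auto intro!: linearI simp: inner_left_distrib inner_right_distrib)
  obtain v l where v: "v \<bullet> v = 1" and ev: "\<And>w. q w v = l * (w \<bullet> v)"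
    and le: "\<And>w. q w w \<le> l * (w \<bullet> w)"
    using rayleigh_maximizer[OF ib inner_commute _ qb qs subspace_UNIV, of u] pos
    by (metis UNIV_I inner_gt_zero_iff inner_zero_left less_irrefl)
  have Av: "A *v v = l *\<^sub>R v"
    using ev by (intro vector_eq_ldot[THEN iffD1]) (auto simp: q_def)
  have l0: "l > 0"
    using le[of u] pos v by (smt (verit) q_def inner_ge_zero zero_less_mult_pos2 mult_nonpos_nonneg)
  have qv: "q v v = l" using ev[of v] v by simp
  have cv: "c \<bullet> v \<noteq> 0"
  proof
    assume "c \<bullet> v = 0"
    moreover have "v \<noteq> 0" using v by auto
    ultimately show False using neg[of v] qv l0 by (simp add: q_def)
  qed
  \<comment> \<open>Moving \<open>w\<close> along \<open>v\<close> into the hyperplane orthogonal to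
    \<open>c\<close> changes its value only by the nonnegative term \<open>t^2 * l\<close>.\<close>
  have wneg: "q w w < 0" if w: "w \<bullet> v = 0" "w \<noteq> 0" for w
  proof -
    define t where "t = c \<bullet> w / (c \<bullet> v)"
    define y where "y = w - t *\<^sub>R v"
    have "c \<bullet> y = 0" using cv by (simp add: y_def t_def inner_diff_right)
    moreover have "y \<noteq> 0"
    proof
      assume "y = 0"
      then have "w = t *\<^sub>R v" by (simp add: y_def)
      then show False using w v by auto
    qed
    ultimately have "q y y < 0" using neg by (simp add: q_def)
    also have "q y y = q w w - 2 * t * q w v + t\<^sup>2 * q v v"
      using qs[of v w] unfolding y_def
      by (simp add: bilinear_lsub[OF qb] bilinear_rsub[OF qb] bilinear_lmul[OF qb]
          bilinear_rmul[OF qb] power2_eq_square algebra_simps)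
    also have "\<dots> = q w w + t\<^sup>2 * l" using ev[of w] w qv by simp
    finally have "q w w + t\<^sup>2 * l < 0" .
    moreover have "t\<^sup>2 * l \<ge> 0" using l0 by simp
    ultimately show ?thesis by linarith
  qed
  have roots: "x = l \<or> x < 0" if "det (mat x - A) = 0" for x
  proof -
    from that obtain w where w: "w \<noteq> 0" "(mat x - A) *v w = 0"
      by (auto simp: det_eq_0_iff_kernel)
    then have Aw: "A *v w = x *\<^sub>R w" by (simp add: mat_minus_mult_vec)
    have "l * (w \<bullet> v) = x * (w \<bullet> v)"
      using ev[of w] qs[of w v] Aw by (simp add: q_def inner_commute)
    then have "x \<noteq> l \<Longrightarrow> w \<bullet> v = 0" by auto
    moreover have "q w w = x * (w \<bullet> w)" by (simp add: q_def Aw)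
    moreover have "w \<bullet> w > 0" using w by simp
    ultimately show ?thesis using wneg[of w] w mult_nonneg_nonneg[of x "w \<bullet> w"] by linarith
  qed
  have "det (mat 0 - A) \<noteq> 0" using roots[of 0] l0 by auto
  then show "det A \<noteq> 0"
    by (metis det_eq_0_iff_kernel mat_minus_mult_vec diff_0 neg_equal_0_iff_equal scale_zero_left)
  \<comment> \<open>This is \<open>A\<close> with the eigenvalue \<open>l\<close> at
    \<open>v\<close> replaced by \<open>-l\<close>.\<close>
  define B where "B = A - (2 * l) *\<^sub>R outer v"
  have Bneg: "w \<bullet> (B *v w) < 0" if "w \<noteq> 0" for w
  proof -
    define t where "t = w \<bullet> v"
    define y where "y = w - t *\<^sub>R v"
    have yv: "y \<bullet> v = 0" using v by (simp add: y_def t_def inner_diff_left)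
    have wy: "w = y + t *\<^sub>R v" by (simp add: y_def)
    have "q w w = q y y + t\<^sup>2 * l"
      using qs[of v y] ev[of y] yv qv unfolding wy
      by (simp add: bilinear_ladd[OF qb] bilinear_radd[OF qb] bilinear_lmul[OF qb]
          bilinear_rmul[OF qb] power2_eq_square algebra_simps)
    moreover have "w \<bullet> (B *v w) = q w w - 2 * l * t\<^sup>2"
      by (simp add: B_def q_def matrix_vector_mult_diff_rdistrib inner_diff_right
         scaleR_matrix_vector_assoc[symmetric] outer_mult_vec t_def inner_commute power2_eq_square)
    ultimately have eq: "w \<bullet> (B *v w) = q y y - l * t\<^sup>2" by simp
    show ?thesis
    proof (cases "y = 0")
      case True
      then have "t \<noteq> 0" using that wy by auto
      then show ?thesis using eq True l0 bilinear_lzero[OF qb] by simp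
    next
      case False
      then have "q y y < 0" using wneg yv by blast
      moreover have "l * t\<^sup>2 \<ge> 0" using l0 by simp
      ultimately show ?thesis using eq by linarith
    qed
  qed
  have detB: "det (mat x - B) \<noteq> 0" if "x \<ge> 0" for x
  proof
    assume "det (mat x - B) = 0"
    then obtain w where w: "w \<noteq> 0" "B *v w = x *\<^sub>R w"
      by (auto simp: det_eq_0_iff_kernel mat_minus_mult_vec)
    then have "x * (w \<bullet> w) < 0" using Bneg[of w] by simp
    then show False using that mult_nonneg_nonneg[OF that inner_ge_zero[of w]] by simp
  qed
  \<comment> \<open>The rank-one factor relating the two matrices has determinant
    \<open>(x + l) / (x - l)\<close>. At the excluded point \<open>x = l\<close> both sides vanish
    by \<open>l_root\<close>.\<close>
  have rel: "(x - l) * det (mat x - B) = (x + l) * det (mat x - A)" if "x \<noteq> l" for x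
  proof -
    have "mat x - B = (mat x - A) ** (mat 1 + (2 * l / (x - l)) *\<^sub>R outer v)"
      unfolding matrix_eq
    proof
      fix w
      have "(mat x - A) *v ((2 * l / (x - l)) *\<^sub>R (v \<bullet> w) *\<^sub>R v) = (2 * l * (v \<bullet> w)) *\<^sub>R v"
        using that
        by (simp add: mat_minus_mult_vec matrix_vector_mult_scaleR Av scaleR_left_diff_distrib[symmetric])
      then show "(mat x - B) *v w = ((mat x - A) ** (mat 1 + (2 * l / (x - l)) *\<^sub>R outer v)) *v w"
        by (simp add: matrix_vector_mul_assoc[symmetric] matrix_vector_mult_add_rdistrib
          matrix_vector_right_distrib scaleR_matrix_vector_assoc[symmetric] outer_mult_vec)
         (simp add: mat_minus_mult_vec B_def matrix_vector_mult_diff_rdistrib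
          scaleR_matrix_vector_assoc[symmetric] outer_mult_vec)
    qed
    then have "det (mat x - B) = det (mat x - A) * (1 + 2 * l / (x - l))"
      using det_mat1_plus_outer[of v] v by (simp add: det_mul norm_eq_1)
    then show ?thesis using that by (simp add: field_simps)
  qed
  have l_root: "det (mat l - A) = 0"
    using Av v by (auto simp: det_eq_0_iff_kernel mat_minus_mult_vec intro!: exI[of _ v])
  have polys: "[:-l, 1:] * charpoly B = [:l, 1:] * charpoly A"
  proof -
    have "poly ([:-l, 1:] * charpoly B) x = poly ([:l, 1:] * charpoly A) x" for x
      using rel[of x] l_root by (cases "x = l") (auto simp: poly_charpoly algebra_simps)
    then show ?thesis by (intro poly_eq_poly_eq_iff[THEN iffD1]) auto
  qed
  have pB: "poly (charpoly B) l \<noteq> 0" using detB[of l] l0 by (simp add: poly_charpoly)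
  then have B0: "charpoly B \<noteq> 0" by auto
  then have n0: "[:-l, 1:] * charpoly B \<noteq> 0" by (simp del: mult_pCons_left)
  have "order l ([:-l, 1:] * charpoly B) = 1"
    using order_mult[OF n0, of l] order_0I[OF pB] order_power_n_n[of l 1]
    by (simp del: mult_pCons_left)
  moreover have "order l ([:l, 1:] * charpoly A) = order l (charpoly A)"
    using order_mult[OF n0[unfolded polys], of l] order_0I[of "[:l, 1:]" l] l0
    by (simp del: mult_pCons_left)
  ultimately have ord: "order l (charpoly A) = 1" using polys by simp
  have "{x. x > 0 \<and> poly (charpoly A) x = 0} = {l}"
    using l0 l_root roots by (force simp: poly_charpoly)
  then show "num_pos_eigenvalues A = 1" by (simp add: num_pos_eigenvalues_def ord)
qed

section \<open>Hyperbolic quadratic forms\<close>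

text \<open>Dividing each row of \<open>C\<close> by its sum gives a Markov operator that is
  self-adjoint for the weights \<open>d\<close>. By \<open>bochner\<close>, a positive top
  eigenvalue on the complement of the constants is at least 1; then its eigenvector has zero
  Dirichlet energy, hence is constant on the support of \<open>d\<close>, which the hub
  \<open>h\<close> connects.\<close>

lemma bochner_hyperbolic:
  fixes C :: "'v::finite \<Rightarrow> 'v \<Rightarrow> real" and z :: "real^'v"
  assumes sym: "\<And>u v. C u v = C v u" and nonneg: "\<And>u v. C u v \<ge> 0"
    and d: "\<And>u. d u = (\<Sum>v\<in>UNIV. C u v)"
    and hub: "\<And>v. d v > 0 \<Longrightarrow> C h v > 0"
    and bochner: "\<And>z :: real^'v. (\<Sum>u\<in>UNIV. \<Sum>v\<in>UNIV. C u v * z $ u * z $ v)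
       \<le> (\<Sum>u\<in>UNIV. (\<Sum>v\<in>UNIV. C u v * z $ v)\<^sup>2 / d u)"
    and orth: "(\<Sum>v\<in>UNIV. d v * z $ v) = 0"
  shows "(\<Sum>u\<in>UNIV. \<Sum>v\<in>UNIV. C u v * z $ u * z $ v) \<le> 0"
proof (rule ccontr)
  assume z: "\<not> ?thesis"
  define q where "q = (\<lambda>x y :: real^'v. \<Sum>u\<in>UNIV. \<Sum>v\<in>UNIV. C u v * x $ u * y $ v)"
  \<comment> \<open>Replacing zero weights by 1 makes \<open>p\<close> positive definite; the
    corresponding rows of \<open>C\<close> vanish by \<open>Cz\<close>.\<close>
  define e where "e = (\<lambda>v. if d v = 0 then 1 else d v)"
  define p where "p = (\<lambda>x y :: real^'v. \<Sum>v\<in>UNIV. e v * x $ v * y $ v)"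
  define W where "W = {x :: real^'v. (\<Sum>v\<in>UNIV. d v * x $ v) = 0}"
  have d0: "d v \<ge> 0" for v by (simp add: d nonneg sum_nonneg)
  have e0: "e v > 0" for v using d0[of v] by (auto simp: e_def)
  have Cz: "C u v = 0" if "d u = 0" for u v
    using that sum_nonneg_eq_0_iff[of UNIV "C u"] by (simp add: d nonneg)
  have qb: "bilinear q"
    unfolding bilinear_def q_def
    by (auto intro!: linearI simp: algebra_simps sum.distrib sum_distrib_left)
  have pb: "bilinear p"
    unfolding bilinear_def p_def
    by (auto intro!: linearI simp: algebra_simps sum.distrib sum_distrib_left)
  have qs: "q x y = q y x" for x y
    unfolding q_def by (subst sum.swap, intro sum.cong refl, subst sym) simp
  have ps: "p x y = p y x" for x y by (simp add: p_def ac_simps)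
  have pp: "p x x > 0" if "x \<noteq> 0" for x
  proof -
    obtain i where "x $ i \<noteq> 0" using \<open>x \<noteq> 0\<close> by (auto simp: vec_eq_iff)
    then show ?thesis unfolding p_def
      using e0 by (intro sum_pos2[of _ i])
        (auto simp: mult.assoc power2_eq_square[symmetric] less_imp_le)
  qed
  have W: "subspace W"
    by (auto simp: subspace_def W_def algebra_simps sum.distrib sum_distrib_left[symmetric])
  have zW: "z \<in> W" "z \<noteq> 0" using orth z by (auto simp: W_def)
  obtain x l where x: "x \<in> W" "p x x = 1" and ev: "\<And>w. w \<in> W \<Longrightarrow> q w x = l * p w x"
    and le: "\<And>w. w \<in> W \<Longrightarrow> q w w \<le> l * p w w"
    using rayleigh_maximizer[OF pb ps pp qb qs W zW] by blast
  have l: "l > 0"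
  proof -
    have "q z z > 0" using z by (simp add: q_def)
    then have "l * p z z > 0" using le[OF zW(1)] by linarith
    then show ?thesis using pp[OF zW(2)] by (simp add: zero_less_mult_iff)
  qed
  have qx: "q x x = l" using ev[OF x(1)] x by simp
  \<comment> \<open>The image of \<open>x\<close> under the Markov operator. Since \<open>ev\<close>
    is known against \<open>W\<close> only, \<open>yW\<close> is needed before it can be applied to
    \<open>y\<close>.\<close>
  define y :: "real^'v" where "y = (\<chi> u. (\<Sum>v\<in>UNIV. C u v * x $ v) / e u)"
  have ey: "e u * y $ u = (\<Sum>v\<in>UNIV. C u v * x $ v)" for u
    using e0[of u] by (simp add: y_def)
  have py: "p w y = q w x" for w
    using ey by (simp add: p_def q_def mult.assoc mult.left_commute[of "e _"] sum_distrib_left)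
      (simp add: mult.left_commute)
  have dy: "d u * y $ u = (\<Sum>v\<in>UNIV. C u v * x $ v)" for u
    using ey[of u] Cz[of u] by (cases "d u = 0") (auto simp: e_def)
  have "(\<Sum>u\<in>UNIV. d u * y $ u) = (\<Sum>v\<in>UNIV. d v * x $ v)"
    unfolding dy by (subst sum.swap) (simp add: d sum_distrib_right sym)
  then have yW: "y \<in> W" using x by (simp add: W_def)
  have "q y x = l\<^sup>2"
    using ev[OF yW] py[of x] ps[of x y] qx by (simp add: power2_eq_square)
  then have "p y y = l\<^sup>2" using py by simp
  moreover have "p y y \<ge> q x x"
  proof -
    have "(\<Sum>v\<in>UNIV. C u v * x $ v)\<^sup>2 / d u = e u * y $ u * y $ u" for u
      using ey[of u, symmetric] Cz[of u] by (cases "d u = 0") (auto simp: e_def power2_eq_square)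
    then show ?thesis using bochner[of x] by (simp add: p_def q_def)
  qed
  ultimately have "l \<le> l\<^sup>2" using qx by simp
  then have l1: "l \<ge> 1" using l by (simp add: power2_eq_square)
  \<comment> \<open>The left side is the Dirichlet energy of \<open>x\<close>; the right side is at
    most 0 because \<open>q x x = l >= 1\<close> and \<open>p x x = 1\<close>.\<close>
  have lap: "(\<Sum>u\<in>UNIV. \<Sum>v\<in>UNIV. C u v * (x $ u - x $ v)\<^sup>2)
      = 2 * (\<Sum>v\<in>UNIV. d v * (x $ v)\<^sup>2) - 2 * q x x"
  proof -
    have "(\<Sum>u\<in>UNIV. \<Sum>v\<in>UNIV. C u v * (x $ u - x $ v)\<^sup>2)
       = (\<Sum>u\<in>UNIV. \<Sum>v\<in>UNIV. C u v * (x $ u)\<^sup>2) + (\<Sum>u\<in>UNIV. \<Sum>v\<in>UNIV. C u v * (x $ v)\<^sup>2)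
         - 2 * q x x"
      unfolding q_def sum_distrib_left
      by (simp add: sum.distrib[symmetric] sum_subtractf[symmetric] power2_eq_square algebra_simps)
    also have "(\<Sum>u\<in>UNIV. \<Sum>v\<in>UNIV. C u v * (x $ v)\<^sup>2) = (\<Sum>u\<in>UNIV. \<Sum>v\<in>UNIV. C u v * (x $ u)\<^sup>2)"
      by (subst sum.swap) (simp add: sym)
    finally show ?thesis by (simp add: d sum_distrib_right)
  qed
  have "(\<Sum>v\<in>UNIV. d v * (x $ v)\<^sup>2) \<le> p x x"
    unfolding p_def power2_eq_square
    by (intro sum_mono) (auto simp: e_def mult.assoc)
  then have "(\<Sum>u\<in>UNIV. \<Sum>v\<in>UNIV. C u v * (x $ u - x $ v)\<^sup>2) \<le> 0"
    and dx: "(\<Sum>v\<in>UNIV. d v * (x $ v)\<^sup>2) > 0"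
    using lap l1 qx x sum_nonneg[of UNIV "\<lambda>u. \<Sum>v\<in>UNIV. C u v * (x $ u - x $ v)\<^sup>2"]
    by (auto simp: nonneg sum_nonneg)
  then have "(\<Sum>u\<in>UNIV. \<Sum>v\<in>UNIV. C u v * (x $ u - x $ v)\<^sup>2) = 0"
    by (intro antisym sum_nonneg) (auto simp: nonneg)
  then have "C h v * (x $ h - x $ v)\<^sup>2 = 0" for v
    by (simp add: sum_nonneg_eq_0_iff nonneg sum_nonneg)
  \<comment> \<open>Where \<open>d\<close> is positive, \<open>x\<close> takes the value
    \<open>x $ h\<close>; membership in \<open>W\<close> then makes every \<open>d v * x $ v\<close>
    vanish, against \<open>dx\<close>.\<close>
  then have const: "d v * x $ v = d v * x $ h" for v
    using hub[of v] d0[of v] \<open>C h v * (x $ h - x $ v)\<^sup>2 = 0\<close>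
    by (cases "d v = 0") (auto simp: less_le)
  then have "(\<Sum>v\<in>UNIV. d v) * x $ h = 0"
    using x(1) by (simp only: sum_distrib_right const[symmetric]) (simp add: W_def)
  then have "d v * x $ v = 0" for v
    using const[of v] by (auto simp: sum_nonneg_eq_0_iff d0)
  then have "(\<Sum>v\<in>UNIV. d v * (x $ v)\<^sup>2) = 0"
    by (intro sum.neutral ballI) (simp add: power2_eq_square)
  then show False using dx by simp
qed

text \<open>If \<open>q y y > 0\<close>, then \<open>q\<close> is positive definite on the plane of
  \<open>a\<close> and \<open>y\<close>. Its vector \<open>w\<close> is orthogonal to
  \<open>u\<close>, which violates \<open>u(2)\<close> at \<open>w\<close>, or at \<open>a\<close>
  in case \<open>q u a = 0\<close>.\<close>

lemma hyperbolic_change_vector: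
  fixes q :: "'a::real_vector \<Rightarrow> 'a \<Rightarrow> real"
  assumes q: "bilinear q" and sym: "\<And>x y. q x y = q y x"
    and u: "q u u > 0" "\<And>y. q u y = 0 \<Longrightarrow> q y y \<le> 0"
    and a: "q a a > 0" and ay: "q a y = 0"
  shows "q y y \<le> 0"
proof (rule ccontr)
  assume y: "\<not> ?thesis"
  define w where "w = q u y *\<^sub>R a - q u a *\<^sub>R y"
  note bl = bilinear_lsub[OF q] bilinear_rsub[OF q] bilinear_lmul[OF q] bilinear_rmul[OF q]
  have "q u w = 0" by (simp add: w_def bl)
  then have "q w w \<le> 0" by (rule u)
  also have "q w w = (q u y)\<^sup>2 * q a a + (q u a)\<^sup>2 * q y y"
    using ay sym[of y a] by (simp add: w_def bl power2_eq_square)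
  finally have "(q u y)\<^sup>2 * q a a + (q u a)\<^sup>2 * q y y \<le> 0" .
  moreover have "(q u a)\<^sup>2 * q y y \<ge> 0" "(q u y)\<^sup>2 * q a a \<ge> 0" using a y by simp_all
  ultimately have "(q u a)\<^sup>2 * q y y = 0" by linarith
  then have "q u a = 0" using y by simp
  then show False using u(2)[of a] a by simp
qed

text \<open>The hypothesis is applied to the component of \<open>y\<close> orthogonal to
  \<open>u\<close>, scaled by \<open>q u u\<close> to avoid a division.\<close>

lemma hyperbolic_imp_reverse_cauchy_schwarz:
  fixes q :: "'a::real_vector \<Rightarrow> 'a \<Rightarrow> real"
  assumes q: "bilinear q" and sym: "\<And>x y. q x y = q y x"
    and u: "q u u > 0" "\<And>y. q u y = 0 \<Longrightarrow> q y y \<le> 0"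
  shows "q u u * q y y \<le> (q u y)\<^sup>2"
proof -
  note bl = bilinear_lsub[OF q] bilinear_rsub[OF q] bilinear_lmul[OF q] bilinear_rmul[OF q]
  let ?w = "q u u *\<^sub>R y - q u y *\<^sub>R u"
  have "q ?w ?w \<le> 0" by (rule u(2)) (simp add: bl)
  also have "q ?w ?w = q u u * (q u u * q y y - (q u y)\<^sup>2)"
    using sym[of y u] by (simp add: bl power2_eq_square algebra_simps)
  finally show ?thesis using u(1) by (simp add: mult_le_0_iff)
qed

section \<open>The polarized independence polynomial of a matroid\<close>

text \<open>Cauchy-Schwarz for the vector of class sums, the number of classes being at most
  \<open>card E\<close>; the double sum on the right is the sum of the squared class sums.\<close>

lemma square_sum_le_sum_over_equivalence:
  fixes y :: "'a \<Rightarrow> real"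
  assumes fin: "finite E"
    and r_refl: "\<And>a. a \<in> E \<Longrightarrow> r a a"
    and r_sym: "\<And>a b. r a b \<Longrightarrow> r b a"
    and r_trans: "\<And>a b c. a \<in> E \<Longrightarrow> b \<in> E \<Longrightarrow> c \<in> E \<Longrightarrow> r a b \<Longrightarrow> r b c \<Longrightarrow> r a c"
  shows "(\<Sum>a\<in>E. y a)\<^sup>2 \<le> real (card E) * (\<Sum>a\<in>E. \<Sum>b | b \<in> E \<and> r a b. y a * y b)"
proof -
  define cls where "cls a = {b \<in> E. r a b}" for a
  have cls_eq: "{x \<in> E. cls x = c} = c" if "c \<in> cls ` E" for c
  proof -
    obtain a where a: "a \<in> E" "c = cls a" using \<open>c \<in> cls ` E\<close> by (elim imageE) auto
    have "cls x = cls a \<longleftrightarrow> r a x" if "x \<in> E" for x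
    proof
      show "r a x" if "cls x = cls a" using that r_refl[OF \<open>x \<in> E\<close>] \<open>x \<in> E\<close> by (auto simp: cls_def)
      show "cls x = cls a" if ax: "r a x"
        using r_trans[OF a(1) \<open>x \<in> E\<close> _ ax] r_trans[OF \<open>x \<in> E\<close> a(1) _ r_sym[OF ax]]
        unfolding cls_def by blast
    qed
    then show ?thesis unfolding a(2) by (auto simp: cls_def[of a])
  qed
  have "(\<Sum>a\<in>E. y a) = (\<Sum>c\<in>cls ` E. \<Sum>x | x \<in> E \<and> cls x = c. y x)"
    using sum.group[of E "cls ` E" cls y] fin by simp
  also have "\<dots> = (\<Sum>c\<in>cls ` E. sum y c)"
    by (rule sum.cong[OF refl]) (simp only: cls_eq)
  finally have "(\<Sum>a\<in>E. y a)\<^sup>2 \<le> real (card (cls ` E)) * (\<Sum>c\<in>cls ` E. (sum y c)\<^sup>2)"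
    using sum_squared_le_sum_of_squares[of "sum y" "cls ` E"] by (simp add: mult.commute)
  also have "\<dots> \<le> real (card E) * (\<Sum>c\<in>cls ` E. (sum y c)\<^sup>2)"
    by (intro mult_right_mono) (simp_all add: card_image_le fin sum_nonneg)
  also have "(\<Sum>c\<in>cls ` E. (sum y c)\<^sup>2) = (\<Sum>c\<in>cls ` E. \<Sum>x | x \<in> E \<and> cls x = c. y x * sum y (cls x))"
  proof (intro sum.cong refl)
    fix c assume c: "c \<in> cls ` E"
    have "cls x = c" if "x \<in> c" for x using cls_eq[OF c] that by blast
    with c show "(sum y c)\<^sup>2 = (\<Sum>x | x \<in> E \<and> cls x = c. y x * sum y (cls x))"
      by (simp add: cls_eq power2_eq_square sum_distrib_right cong: sum.cong)
  qed
  also have "\<dots> = (\<Sum>x\<in>E. y x * sum y (cls x))"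
    by (rule sum.group) (use fin in auto)
  finally show ?thesis by (simp add: cls_def sum_distrib_left)
qed

section \<open>Matroids by independent sets, and their polarization\<close>

locale matroid_independence =
  fixes indep :: "'e::finite set \<Rightarrow> bool"
  assumes indep_subset: "indep T \<Longrightarrow> S \<subseteq> T \<Longrightarrow> indep S"
    and augment: "indep S \<Longrightarrow> indep T \<Longrightarrow> card S < card T \<Longrightarrow> \<exists>x\<in>T - S. indep (insert x S)"
begin

text \<open>For independent \<open>I\<close>, the non-loops of the contraction by
  \<open>I\<close>.\<close>

definition ext :: "'e set \<Rightarrow> 'e set" where
  "ext I = {a. a \<notin> I \<and> indep (insert a I)}"

text \<open>For independent \<open>I\<close> and \<open>CARD('e) - card I\<close> arguments, this is
  the iterated directional derivative of the independence polynomial of the contraction by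
  \<open>I\<close>; the base value is the factorial left by the power of \<open>w_0\<close>. An
  argument \<open>axis None 1\<close> changes nothing, so a shorter list means that the missing
  derivatives are taken in \<open>w_0\<close>.\<close>

primrec polar :: "(real^'e option) list \<Rightarrow> 'e set \<Rightarrow> real" where
  "polar [] I = fact (CARD('e) - card I)"
| "polar (x # xs) I = x $ None * polar xs I + (\<Sum>a\<in>ext I. x $ Some a * polar xs (insert a I))"

declare polar.simps(2) [simp del]

text \<open>The coordinate derivatives of the polarization. Treating \<open>None\<close> and the
  elements alike lets inequalities be summed over all coordinates.\<close>

definition slot :: "'e option \<Rightarrow> (real^'e option) list \<Rightarrow> 'e set \<Rightarrow> real" where
  "slot v xs I = (case v of None \<Rightarrow> polar xs I
     | Some a \<Rightarrow> if a \<in> ext I then polar xs (insert a I) else 0)"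

lemma polar_Cons_slot: "polar (x # xs) I = (\<Sum>v\<in>UNIV. x $ v * slot v xs I)"
proof -
  have "(\<Sum>v\<in>UNIV. x $ v * slot v xs I) = x $ None * polar xs I
      + (\<Sum>a\<in>UNIV. if a \<in> ext I then x $ Some a * polar xs (insert a I) else 0)"
    by (simp add: polar.simps(2) UNIV_option_conv sum.reindex slot_def if_distrib[of "\<lambda>u. _ * u"] o_def cong: if_cong)
  then show ?thesis by (simp add: sum.If_cases polar.simps(2))
qed

lemma polar_axis: "polar (axis u 1 # xs) I = slot u xs I"
  by (simp add: polar_Cons_slot axis_def if_distrib[of "\<lambda>u. u * _"] cong: if_cong)

lemma ext_insert:
  "a \<in> ext I \<Longrightarrow> ext (insert a I) = {b \<in> ext I. b \<noteq> a \<and> indep (insert a (insert b I))}"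
  unfolding ext_def by (auto simp: insert_commute intro: indep_subset)

text \<open>Being addable to \<open>I\<close> one after the other is a symmetric relation; this is
  what makes \<open>polar\<close> symmetric.\<close>

lemma sum_ext_swap:
  "(\<Sum>a\<in>ext I. \<Sum>b\<in>ext (insert a I). g a b) = (\<Sum>b\<in>ext I. \<Sum>a\<in>ext (insert b I). g a b)"
  using sum.swap_restrict[of "ext I" "ext I" g "\<lambda>a b. b \<noteq> a \<and> indep (insert a (insert b I))"]
  by (simp add: ext_insert insert_commute eq_commute[of _ "_::'e"] cong: sum.cong)

lemma polar_swap: "polar (x # y # xs) I = polar (y # x # xs) I"
proof -
  have "(\<Sum>a\<in>ext I. \<Sum>b\<in>ext (insert a I). x $ Some a * (y $ Some b * polar xs (insert b (insert a I))))
    = (\<Sum>a\<in>ext I. \<Sum>b\<in>ext (insert a I). y $ Some a * (x $ Some b * polar xs (insert b (insert a I))))"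
    by (subst sum_ext_swap) (simp add: insert_commute mult.left_commute)
  then show ?thesis
    by (simp add: polar.simps(2) distrib_left sum.distrib sum_distrib_left mult.left_commute)
qed

lemma polar_rotate: "polar (x # y # z # xs) I = polar (z # x # y # xs) I"
proof -
  have "polar (x # y # z # xs) I = polar (x # z # y # xs) I"
    using polar_swap[of y z xs] by (simp add: polar.simps(2))
  then show ?thesis using polar_swap[of x z] by simp
qed

lemma polar_move_front: "x \<in> set xs \<Longrightarrow> polar xs I = polar (x # remove1 x xs) I"
proof (induction xs arbitrary: I)
  case (Cons y ys)
  show ?case
  proof (cases "x = y")
    case False
    then have "polar (y # ys) I = polar (y # x # remove1 x ys) I"
      using Cons by (simp add: polar.simps(2)[of y])
    then show ?thesis using False polar_swap by simp
  qed simp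
qed simp

lemma polar_mset: "mset xs = mset ys \<Longrightarrow> polar xs I = polar ys I"
proof (induction xs arbitrary: ys I)
  case (Cons x xs)
  then have x: "x \<in> set ys" and "mset xs = mset (remove1 x ys)"
    by (metis list.set_intros(1) mset_eq_setD, metis mset_remove1 remove1.simps(2) mset.simps(2) add_mset_remove_trivial)
  then have "polar (x # xs) I = polar (x # remove1 x ys) I"
    using Cons.IH[of "remove1 x ys"] by (simp only: polar.simps(2))
  then show ?case by (simp add: polar_move_front[OF x])
qed simp

lemma bilinear_polar: "bilinear (\<lambda>x y. polar (x # y # xs) I)"
proof -
  have lin: "linear (\<lambda>x. polar (x # ys) J)" for ys J
    by (intro linearI) (simp_all add: polar.simps(2) algebra_simps sum.distrib sum_distrib_left)
  then have "linear (\<lambda>y. polar (x # y # xs) I)" for x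
    using lin[of "x # xs" I] polar_swap[of x _ xs I] by simp
  with lin show ?thesis by (simp add: bilinear_def)
qed

lemma polar_pos: "(\<And>x v. x \<in> set xs \<Longrightarrow> x $ v > 0) \<Longrightarrow> polar xs I > 0"
  by (induction xs arbitrary: I)
    (auto simp: polar.simps(2) less_imp_le intro!: add_pos_nonneg sum_nonneg mult_nonneg_nonneg)

lemma polar_nonneg: "(\<And>x v. x \<in> set xs \<Longrightarrow> x $ v \<ge> 0) \<Longrightarrow> polar xs I \<ge> 0"
  by (induction xs arbitrary: I)
    (auto simp: polar.simps(2) intro!: add_nonneg_nonneg sum_nonneg mult_nonneg_nonneg)

text \<open>The relation \<open>r\<close> is parallelism in the contraction by \<open>I\<close>,
  transitive by augmentation. The difference on the right sums over parallel pairs, so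
  Cauchy-Schwarz over parallel classes applies, and at most \<open>m\<close> elements lie outside
  \<open>I\<close>.\<close>

lemma sum_ext_ext_le:
  fixes y :: "'e \<Rightarrow> real"
  assumes I: "indep I" and m: "m = CARD('e) - card I"
  shows "(\<Sum>a\<in>ext I. y a)\<^sup>2 \<le> m * ((\<Sum>a\<in>ext I. y a)\<^sup>2 - (\<Sum>a\<in>ext I. \<Sum>b\<in>ext (insert a I). y a * y b))"
proof -
  define r where "r a b \<longleftrightarrow> a = b \<or> \<not> indep (insert a (insert b I))" for a b
  have tr: "r a c" if E: "a \<in> ext I" "b \<in> ext I" "c \<in> ext I" and r: "r a b" "r b c" for a b c
  proof (rule ccontr)
    assume "\<not> r a c"
    then have ac: "a \<noteq> c" "indep (insert a (insert c I))" by (auto simp: r_def)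
    have "card (insert b I) < card (insert a (insert c I))"
      using E ac by (simp add: ext_def)
    then obtain x where "x \<in> insert a (insert c I) - insert b I" "indep (insert x (insert b I))"
      using augment[of "insert b I" "insert a (insert c I)"] E ac by (auto simp: ext_def)
    then show False using r ac by (auto simp: r_def insert_commute)
  qed
  have split: "(\<Sum>b\<in>ext I. y a * y b) = (\<Sum>b | b \<in> ext I \<and> r a b. y a * y b) + (\<Sum>b\<in>ext (insert a I). y a * y b)"
    if "a \<in> ext I" for a
  proof -
    have "ext I = {b \<in> ext I. r a b} \<union> ext (insert a I)" "{b \<in> ext I. r a b} \<inter> ext (insert a I) = {}"
      using that by (auto simp: ext_insert r_def)
    then show ?thesis by (metis finite sum.union_disjoint)
  qed
  have "(\<Sum>a\<in>ext I. y a)\<^sup>2 = (\<Sum>a\<in>ext I. \<Sum>b\<in>ext I. y a * y b)"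
    by (simp add: power2_eq_square sum_product)
  also have "\<dots> = (\<Sum>a\<in>ext I. \<Sum>b | b \<in> ext I \<and> r a b. y a * y b)
      + (\<Sum>a\<in>ext I. \<Sum>b\<in>ext (insert a I). y a * y b)"
    by (simp add: split sum.distrib)
  finally have T: "(\<Sum>a\<in>ext I. \<Sum>b | b \<in> ext I \<and> r a b. y a * y b)
    = (\<Sum>a\<in>ext I. y a)\<^sup>2 - (\<Sum>a\<in>ext I. \<Sum>b\<in>ext (insert a I). y a * y b)" by simp
  have sq: "(\<Sum>a\<in>ext I. y a)\<^sup>2 \<le> real (card (ext I)) * (\<Sum>a\<in>ext I. \<Sum>b | b \<in> ext I \<and> r a b. y a * y b)"
  proof (rule square_sum_le_sum_over_equivalence)
    show "r a a" for a by (simp add: r_def)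
    show "r b a" if "r a b" for a b using that insert_commute[of a b I] by (auto simp: r_def)
    show "r a c" if "a \<in> ext I" "b \<in> ext I" "c \<in> ext I" "r a b" "r b c" for a b c
      using that by (rule tr)
  qed simp
  have "card (ext I) \<le> card (- I)" by (rule card_mono) (auto simp: ext_def)
  then have cm: "card (ext I) \<le> m" by (simp add: m Compl_eq_Diff_UNIV card_Diff_subset)
  show ?thesis
  \<comment> \<open>Replacing \<open>card (ext I)\<close> by \<open>m\<close> needs a nonnegative
    factor; by \<open>sq\<close> it could be negative only for empty \<open>ext I\<close>, where
    both sides vanish.\<close>
  proof (cases "(\<Sum>a\<in>ext I. \<Sum>b | b \<in> ext I \<and> r a b. y a * y b) \<ge> 0")
    case True
    then show ?thesis using sq cm unfolding T[symmetric]
      by (meson mult_right_mono of_nat_le_iff order_trans)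
  next
    case False
    moreover have "0 \<le> real (card (ext I)) * (\<Sum>a\<in>ext I. \<Sum>b | b \<in> ext I \<and> r a b. y a * y b)"
      using sq zero_le_power2 by (rule order_trans[rotated])
    ultimately have "card (ext I) = 0" by (simp add: zero_le_mult_iff)
    then show ?thesis by simp
  qed
qed

text \<open>The form is \<open>fact m * y0^2 + 2 * fact (m - 1) * s * y0 + fact (m - 2) * T\<close>
  with \<open>y0 = y $ None\<close>. For \<open>m >= 2\<close>, eliminating \<open>y0\<close> leaves
  a positive multiple of \<open>m * T - (m - 1) * s^2\<close>, which \<open>sum_ext_ext_le\<close>
  bounds by 0.\<close>

lemma polar_quadratic_hyperbolic:
  assumes I: "indep I" and 0: "polar [axis None 1, y] I = 0"
  shows "polar [y, y] I \<le> 0"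
proof -
  define m where "m = CARD('e) - card I"
  define s where "s = (\<Sum>a\<in>ext I. y $ Some a)"
  define T where "T = (\<Sum>a\<in>ext I. \<Sum>b\<in>ext (insert a I). y $ Some a * y $ Some b)"
  have c1: "CARD('e) - card (insert a J) = CARD('e) - card J - 1" if "a \<in> ext J" for a J
    using that by (simp add: ext_def)
  have lin: "fact m * y $ None + fact (m - 1) * s = 0"
  proof -
    have "(\<Sum>a\<in>ext I. y $ Some a * fact (CARD('e) - card (insert a I))) = fact (m - 1) * s"
      unfolding s_def sum_distrib_left by (intro sum.cong refl) (simp add: c1 m_def)
    then show ?thesis using 0 by (simp add: polar.simps(2) axis_def m_def ac_simps)
  qed
  have "polar [y, y] I = y $ None * (fact m * y $ None + fact (m - 1) * s)
     + fact (m - 1) * s * y $ None + fact (m - 2) * T"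
  proof -
    have "(\<Sum>a\<in>ext I. y $ Some a * polar [y] (insert a I))
       = (\<Sum>a\<in>ext I. fact (m - 1) * y $ Some a * y $ None
           + fact (m - 2) * (\<Sum>b\<in>ext (insert a I). y $ Some a * y $ Some b))"
    proof (intro sum.cong refl)
      fix a assume a: "a \<in> ext I"
      have "(\<Sum>b\<in>ext (insert a I). y $ Some b * fact (CARD('e) - card (insert b (insert a I))))
         = (\<Sum>b\<in>ext (insert a I). y $ Some b * fact (m - 2))"
        by (intro sum.cong refl) (simp add: c1 a m_def numeral_2_eq_2)
      then show "y $ Some a * polar [y] (insert a I) = fact (m - 1) * y $ Some a * y $ None
           + fact (m - 2) * (\<Sum>b\<in>ext (insert a I). y $ Some a * y $ Some b)"
        by (simp add: polar.simps(2) c1[OF a] m_def[symmetric] sum_distrib_left sum_distrib_right algebra_simps)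
    qed
    moreover have "(\<Sum>a\<in>ext I. y $ Some a * fact (CARD('e) - card (insert a I))) = fact (m - 1) * s"
      unfolding s_def sum_distrib_left by (intro sum.cong refl) (simp add: c1 m_def)
    ultimately show ?thesis
      by (simp add: polar.simps(2)[of y "[y]"] polar.simps(2)[of y "[]" I] s_def T_def m_def[symmetric] sum.distrib sum_distrib_left sum_distrib_right)
  qed
  then have pol: "polar [y, y] I = fact (m - 1) * s * y $ None + fact (m - 2) * T"
    using lin by simp
  have key: "s\<^sup>2 \<le> m * (s\<^sup>2 - T)"
    unfolding s_def T_def by (rule sum_ext_ext_le[OF I m_def])
  \<comment> \<open>Truncated subtraction breaks
    \<open>fact (m - 1) = (m - 1) * fact (m - 2)\<close> for \<open>m\<close> at most 1.\<close>
  consider "m = 0" | "m = 1" | k where "m = Suc (Suc k)"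
    by (metis One_nat_def not0_implies_Suc)
  then show ?thesis
  proof cases
    case 1
    have "card (- I) = 0" using 1 by (simp add: m_def Compl_eq_Diff_UNIV card_Diff_subset)
    then have "ext I = {}" by (auto simp: ext_def)
    then show ?thesis using pol by (simp add: s_def T_def)
  next
    case 2
    then have "y $ None = - s" "T \<le> 0" using lin key by simp_all
    moreover have "polar [y, y] I = T - s * s" using pol 2 \<open>y $ None = - s\<close> by simp
    ultimately show ?thesis using zero_le_square[of s] by linarith
  next
    case 3
    define M where "M = real k + 2"
    have "fact (Suc k) * (M * y $ None + s) = 0"
      using lin 3 by (simp add: M_def algebra_simps)
    then have "M * y $ None + s = 0" by simp
    then have My: "M * y $ None = - s" by linarith
    have "polar [y, y] I = fact k * ((k + 1) * s * y $ None + T)"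
      using pol 3 by (simp add: algebra_simps)
    then have "M * polar [y, y] I = fact k * ((k + 1) * s * (M * y $ None) + M * T)"
      by (simp add: algebra_simps)
    also have "\<dots> = fact k * (M * T - (M - 1) * s\<^sup>2)"
      unfolding My by (simp add: M_def power2_eq_square algebra_simps)
    also have "\<dots> \<le> 0"
      using key 3 by (intro mult_nonneg_nonpos) (auto simp: M_def algebra_simps)
    finally have "M * polar [y, y] I \<le> 0" .
    moreover have "M > 0" by (simp add: M_def)
    ultimately show ?thesis by (simp add: mult_le_0_iff)
  qed
qed

section \<open>The Alexandrov-Fenchel inequality\<close>

lemma polar_expand: "polar (axis u 1 # y # xs) I = (\<Sum>v\<in>UNIV. y $ v * polar (axis u 1 # axis v 1 # xs) I)"
proof -
  have "polar (axis u 1 # y # xs) I = polar (y # axis u 1 # xs) I" by (rule polar_swap)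
  also have "\<dots> = (\<Sum>v\<in>UNIV. y $ v * polar (axis v 1 # axis u 1 # xs) I)"
    by (simp only: polar_Cons_slot[of y] polar_axis)
  finally show ?thesis by (simp only: polar_swap[of "axis u 1"])
qed

text \<open>In the induction step the next argument \<open>x\<close> may serve as reference vector.
  Expanding it in coordinates reduces the Bochner hypothesis to inequalities with one argument
  fewer, for \<open>I\<close> and its one-element independent extensions.\<close>

lemma polar_hyperbolic:
  assumes "indep I" "\<And>x v. x \<in> set xs \<Longrightarrow> x $ v > 0" "\<And>v. a $ v > 0" "polar (a # y # xs) I = 0"
  shows "polar (y # y # xs) I \<le> 0"
  using assms
proof (induction xs arbitrary: I a y)
  case Nil
  \<comment> \<open>The quadratic case uses \<open>axis None 1\<close>, which is not strictly
    positive; positivity of the form there is enough to pass to \<open>a\<close>.\<close>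
  have "polar [axis None 1, axis None 1] I > 0" by (simp add: polar.simps(2) axis_def)
  with Nil show ?case
    using hyperbolic_change_vector[OF bilinear_polar polar_swap, of "axis None 1" "[]" I a y]
      polar_quadratic_hyperbolic polar_pos[of "[a, a]" I]
    by (auto)
next
  case (Cons x xs)
  have x: "x $ v > 0" for v using Cons.prems(2) by simp
  have xs: "w $ v > 0" if "w \<in> set xs" for w v using Cons.prems(2) that by simp
  \<comment> \<open>The induction hypothesis in each coordinate: \<open>None\<close> keeps
    \<open>I\<close>, an element of \<open>ext I\<close> enlarges it, and at any other element both
    sides are 0.\<close>
  have rcs: "slot v (x # x # xs) I * slot v (y # y # xs) I \<le> (slot v (y # x # xs) I)\<^sup>2" for v y
  proof -
    have "polar (x # x # xs) J * polar (y # y # xs) J \<le> (polar (y # x # xs) J)\<^sup>2" if "indep J" for J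
      using hyperbolic_imp_reverse_cauchy_schwarz[OF bilinear_polar polar_swap, of x xs J y]
        Cons.IH[OF that xs, of x] x xs polar_pos[of "x # x # xs" J] polar_swap[of x y]
      by (auto)
    then show ?thesis
      using Cons.prems(1) by (auto simp: slot_def ext_def split: option.splits)
  qed
  have x_hyp: "polar (y # y # x # xs) I \<le> 0" if y: "polar (x # y # x # xs) I = 0" for y
  proof -
    have xxs: "polar (x # x # xs) J > 0" for J by (rule polar_pos) (use x xs in auto)
    \<comment> \<open>Rescaling coordinates by \<open>x\<close> turns the argument \<open>x\<close>
      into the all-ones vector, so pairing with it gives the row sums \<open>d\<close> of this
      Hessian.\<close>
    define C where "C u v = x $ u * x $ v * polar (axis u 1 # axis v 1 # x # xs) I" for u v
    define d where "d u = x $ u * slot u (x # x # xs) I" for u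
    define q where "q z = (\<Sum>u\<in>UNIV. \<Sum>v\<in>UNIV. C u v * z $ u * z $ v)" for z :: "real^'e option"
    have row: "(\<Sum>v\<in>UNIV. C u v * z $ v) = x $ u * slot u ((\<chi> v. x $ v * z $ v) # x # xs) I" for u z
      by (simp add: polar_axis[symmetric] polar_expand[of _ "\<chi> v. _ v"] C_def sum_distrib_left ac_simps)
    have q: "q z = polar ((\<chi> v. x $ v * z $ v) # (\<chi> v. x $ v * z $ v) # x # xs) I" for z
    proof -
      have "q z = (\<Sum>u\<in>UNIV. z $ u * (\<Sum>v\<in>UNIV. C u v * z $ v))"
        by (simp add: q_def sum_distrib_left ac_simps)
      then show ?thesis unfolding row by (simp add: polar_Cons_slot[of "\<chi> v. _ v"] ac_simps)
    qed
    \<comment> \<open>For strictly positive lists, whether a slot is positive depends only on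
      \<open>v\<close> and \<open>I\<close>.\<close>
    have slot_pos: "slot v L I \<ge> 0" "slot v L I > 0 \<longleftrightarrow> slot v (x # x # xs) I > 0"
      if "\<And>w v. w \<in> set L \<Longrightarrow> w $ v > 0" for v L
      using polar_pos[of L, OF that] xxs
      by (auto simp: slot_def less_imp_le split: option.splits)
    let ?z = "\<chi> v. y $ v / x $ v"
    have "q ?z \<le> 0"
      unfolding q_def
    proof (rule bochner_hyperbolic[where d = d and h = None])
      show "C u v = C v u" for u v by (simp add: C_def polar_swap[of "axis u 1"])
      have "polar (axis u 1 # axis v 1 # x # xs) I \<ge> 0" for u v
        by (rule polar_nonneg) (use x xs in \<open>auto simp: axis_def less_imp_le\<close>)
      then show "C u v \<ge> 0" for u v
        unfolding C_def by (intro mult_nonneg_nonneg) (auto intro: less_imp_le x)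
      show "d u = (\<Sum>v\<in>UNIV. C u v)" for u
        using row[of u "\<chi> v. 1"] by (simp add: d_def)
      \<comment> \<open>\<open>None\<close> is a hub because choosing it leaves \<open>I\<close>,
        and hence the set of addable elements, unchanged.\<close>
      show "C None v > 0" if "d v > 0" for v
      proof -
        have "slot v (x # xs) I > 0"
          using that x[of v] slot_pos(2)[of "x # xs" v] x xs by (auto simp: d_def zero_less_mult_iff)
        moreover have "polar (axis None 1 # axis v 1 # x # xs) I = slot v (x # xs) I"
          by (simp add: polar_axis slot_def[of None])
        ultimately show ?thesis using x unfolding C_def by simp
      qed
      show "(\<Sum>u\<in>UNIV. \<Sum>v\<in>UNIV. C u v * z $ u * z $ v) \<le> (\<Sum>u\<in>UNIV. (\<Sum>v\<in>UNIV. C u v * z $ v)\<^sup>2 / d u)"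
        for z
      proof -
        define w where "w = (\<chi> v. x $ v * z $ v)"
        \<comment> \<open>With \<open>x\<close> in front, its coordinate expansion exposes the slots
          to which \<open>rcs\<close> applies.\<close>
        have "q z = polar (x # w # w # xs) I"
          unfolding q w_def[symmetric] by (rule polar_rotate)
        also have "\<dots> = (\<Sum>u\<in>UNIV. x $ u * slot u (w # w # xs) I)" by (rule polar_Cons_slot)
        also have "\<dots> \<le> (\<Sum>u\<in>UNIV. (x $ u * slot u (w # x # xs) I)\<^sup>2 / d u)"
        proof (intro sum_mono)
          fix u
          show "x $ u * slot u (w # w # xs) I \<le> (x $ u * slot u (w # x # xs) I)\<^sup>2 / d u"
          proof (cases "slot u (x # x # xs) I > 0")
            case True
            then show ?thesis
              using rcs[of u w] x[of u] by (simp add: d_def power2_eq_square field_simps)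
          next
            \<comment> \<open>Here \<open>u\<close> cannot be added to \<open>I\<close>: the left
              side and \<open>d u\<close> are 0, and division by 0 gives 0 on the right.\<close>
            case False
            then have "slot u (w # w # xs) I = 0"
              using xxs
              by (auto simp: slot_def split: option.splits if_splits)
            then show ?thesis using x[of u] slot_pos(1)[of "x # x # xs" u] x xs
              by (auto simp: d_def less_imp_le intro!: divide_nonneg_nonneg mult_nonneg_nonneg)
          qed
        qed
        finally show ?thesis unfolding row w_def[symmetric] by (simp add: q_def)
      qed
      have "(\<Sum>v\<in>UNIV. d v * ?z $ v) = (\<Sum>v\<in>UNIV. y $ v * slot v (x # x # xs) I)"
        using x by (intro sum.cong) (auto simp: d_def less_le)
      also have "\<dots> = polar (y # x # x # xs) I" by (simp only: polar_Cons_slot)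
      also have "\<dots> = 0" using y by (simp only: polar_swap[of y x])
      finally show "(\<Sum>v\<in>UNIV. d v * ?z $ v) = 0" .
    qed
    moreover have "(\<chi> v. x $ v * ?z $ v) = y"
      using x by (simp add: vec_eq_iff less_le)
    ultimately show ?thesis unfolding q by simp
  qed
  show ?case
    using hyperbolic_change_vector[OF bilinear_polar polar_swap, of x "x # xs" I a y]
      x_hyp Cons.prems polar_pos[of "a # a # x # xs" I] polar_pos[of "x # x # x # xs" I] x xs
    by (auto)
qed

end

section \<open>Enveloping matroids\<close>

lemma (in matroid_independence) augment_to_card:
  assumes "indep S" "indep T"
  obtains S' where "S \<subseteq> S'" "S' \<subseteq> S \<union> T" "indep S'" "card T \<le> card S'"
proof -
  have "\<exists>S'. S \<subseteq> S' \<and> S' \<subseteq> S \<union> T \<and> indep S' \<and> card T \<le> card S'"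
    using assms(1)
  proof (induction "card T - card S" arbitrary: S)
    case 0
    then show ?case by (intro exI[of _ S]) auto
  next
    case (Suc k)
    then have "card S < card T" by simp
    then obtain x where x: "x \<in> T - S" "indep (insert x S)"
      using augment[OF Suc.prems assms(2)] by blast
    have "k = card T - card (insert x S)" using Suc(2) x by auto
    then obtain S' where "insert x S \<subseteq> S'" "S' \<subseteq> insert x S \<union> T" "indep S'" "card T \<le> card S'"
      using Suc(1)[of "insert x S"] x by blast
    then show ?case using x by (intro exI[of _ S']) auto
  qed
  with that show thesis by blast
qed

text \<open>Each exchange brings \<open>B1\<close> one element closer to \<open>B2\<close> without
  changing its size.\<close>

lemma matroid_bases_card_le:
  assumes "matroid_bases E Bs" "B1 \<in> Bs" "B2 \<in> Bs"
  shows "card B1 \<le> card B2"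
  using assms(2)
proof (induction "card (B1 - B2)" arbitrary: B1)
  have fin: "finite B" if "B \<in> Bs" for B
    using assms(1) that unfolding matroid_bases_def by (metis finite_subset)
  {
    case 0
    then have "B1 \<subseteq> B2" using fin by simp
    then show ?case using fin[OF assms(3)] by (intro card_mono)
  next
    case (Suc k)
    then obtain x where x: "x \<in> B1 - B2" by (metis card.empty ex_in_conv nat.distinct(1))
    then obtain y where y: "y \<in> B2 - B1" "insert y (B1 - {x}) \<in> Bs"
      using assms(1,3) Suc.prems unfolding matroid_bases_def by blast
    have "insert y (B1 - {x}) - B2 = (B1 - B2) - {x}" using x y by auto
    then have "k = card (insert y (B1 - {x}) - B2)"
      using Suc.hyps(2) x by simp
    then have "card (insert y (B1 - {x})) \<le> card B2" using Suc.hyps(1) y by blast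
    moreover have "card (insert y (B1 - {x})) = card B1"
      using x y fin[OF Suc.prems] by (simp add: card.insert_remove) (metis One_nat_def Suc_pred card_gt_0_iff empty_iff)
    ultimately show ?case by simp
  }
qed

lemma matroid_bases_card_eq:
  "matroid_bases E Bs \<Longrightarrow> B1 \<in> Bs \<Longrightarrow> B2 \<in> Bs \<Longrightarrow> card B1 = card B2"
  by (intro antisym matroid_bases_card_le)

text \<open>A basis \<open>B2\<close> containing \<open>T\<close> with fewest elements outside
  \<open>T\<close> and \<open>B1\<close> has none there, by exchange against \<open>B1\<close>. If
  no element could be added to \<open>S\<close>, then \<open>B2 - B1 = T - S\<close> and
  \<open>B1 - B2\<close> lies in \<open>S - T\<close>; equal basis sizes contradict
  \<open>card S < card T\<close>.\<close>

lemma matroid_bases_augment: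
  assumes M: "matroid_bases E Bs" and S: "S \<subseteq> B1" "B1 \<in> Bs" and T: "T \<subseteq> B0" "B0 \<in> Bs"
    and card: "card S < card T"
  shows "\<exists>x\<in>T - S. \<exists>B\<in>Bs. insert x S \<subseteq> B"
proof (rule ccontr)
  assume none: "\<not> ?thesis"
  have fin: "finite B" if "B \<in> Bs" for B
    using M that unfolding matroid_bases_def by (metis finite_subset)
  have exch: "\<exists>y\<in>B' - B. insert y (B - {x}) \<in> Bs" if "B \<in> Bs" "B' \<in> Bs" "x \<in> B - B'" for B B' x
    using M that by (auto simp: matroid_bases_def)
  obtain B2 where B2: "B2 \<in> Bs" "T \<subseteq> B2"
    and min: "\<And>B. B \<in> Bs \<Longrightarrow> T \<subseteq> B \<Longrightarrow> card (B2 - (T \<union> B1)) \<le> card (B - (T \<union> B1))"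
    using ex_has_least_nat[of "\<lambda>B. B \<in> Bs \<and> T \<subseteq> B" B0 "\<lambda>B. card (B - (T \<union> B1))"] T by blast
  have sub: "B2 - (T \<union> B1) = {}"
  proof (rule ccontr)
    assume "\<not> ?thesis"
    then obtain x where x: "x \<in> B2" "x \<notin> T" "x \<notin> B1" by blast
    then obtain y where y: "y \<in> B1 - B2" "insert y (B2 - {x}) \<in> Bs"
      using exch[OF B2(1) S(2), of x] by blast
    have "insert y (B2 - {x}) - (T \<union> B1) = (B2 - (T \<union> B1)) - {x}" using y by auto
    then have "card (insert y (B2 - {x}) - (T \<union> B1)) < card (B2 - (T \<union> B1))"
      using x fin[OF B2(1)] by (simp only:) (intro card_Diff1_less; simp)
    moreover have "T \<subseteq> insert y (B2 - {x})" using B2 x by auto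
    ultimately show False using min[OF y(2)] by simp
  qed
  have "x \<notin> B1" if x: "x \<in> T - S" for x
  proof
    assume "x \<in> B1"
    then have "insert x S \<subseteq> B1" using S by blast
    then show False using none x S(2) by blast
  qed
  then have d1: "B2 - B1 = T - S" using sub B2(2) S(1) by blast
  \<comment> \<open>An element of \<open>B1 - B2\<close> outside \<open>S\<close> could be exchanged
    for an element of \<open>T - S\<close> while keeping \<open>S\<close>.\<close>
  have "B1 - B2 \<subseteq> S"
  proof
    fix x assume x: "x \<in> B1 - B2"
    show "x \<in> S"
    proof (rule ccontr)
      assume "x \<notin> S"
      obtain y where y: "y \<in> B2 - B1" "insert y (B1 - {x}) \<in> Bs"
        using exch[OF S(2) B2(1) x] by blast
      moreover have "insert y S \<subseteq> insert y (B1 - {x})" using S(1) \<open>x \<notin> S\<close> by blast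
      ultimately show False using none d1 by blast
    qed
  qed
  then have d2: "B1 - B2 \<subseteq> S - T" using B2 by auto
  have fS: "finite S" "finite T" using S T fin by (auto intro: finite_subset)
  have "card (T - S) = card (B1 - B2)"
    using matroid_bases_card_eq[OF M S(2) B2(1)] card_Int_Diff[OF fin[OF S(2)], of B2]
      card_Int_Diff[OF fin[OF B2(1)], of B1]
    by (simp add: d1[symmetric] Int_commute)
  also have "\<dots> \<le> card (S - T)" using d2 fS by (intro card_mono) auto
  finally show False using card_less_sym_Diff[OF fS card] by linarith
qed

lemma matroid_independence_bases:
  assumes "matroid_bases UNIV (Bs :: 'e::finite set set)"
  shows "matroid_independence (\<lambda>S. \<exists>B\<in>Bs. S \<subseteq> B)"
proof
  show "\<exists>B\<in>Bs. S \<subseteq> B" if "\<exists>B\<in>Bs. T \<subseteq> B" "S \<subseteq> T" for S T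
    using that by blast
  show "\<exists>x\<in>T - S. \<exists>B\<in>Bs. insert x S \<subseteq> B"
    if "\<exists>B\<in>Bs. S \<subseteq> B" "\<exists>B\<in>Bs. T \<subseteq> B" "card S < card T" for S T
    using matroid_bases_augment[OF assms] that by blast
qed

section \<open>Linear functionals on the two polytopes\<close>

lemma eset_nth: "eset B $ i = of_bool ((i, False) \<in> B) - of_bool ((i, True) \<in> B)"
proof -
  have "eset B $ i = (\<Sum>a\<in>B. (if a = (i, False) then 1 else 0) - (if a = (i, True) then 1 else 0))"
    unfolding eset_def sum_component by (intro sum.cong refl) (auto simp: evec_def axis_def)
  then show ?thesis by (simp add: sum_subtractf)
qed

lemma env_uvec: "env (uvec B) = eset B"
  by (simp add: vec_eq_iff env_def uvec_def eset_nth)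

lemma env_matroid_polytope: "env ` matroid_polytope Bs = convex hull (eset ` Bs)"
proof -
  have "linear env" by (intro linearI) (auto simp: env_def vec_eq_iff algebra_simps)
  then have "env ` (convex hull (uvec ` Bs)) = convex hull (env ` uvec ` Bs)"
    by (rule convex_hull_linear_image)
  then show ?thesis by (simp add: matroid_polytope_def image_image env_uvec)
qed

lemma convex_hull_exists_inner_ge:
  assumes "x \<in> convex hull A"
  shows "\<exists>a\<in>A. c \<bullet> x \<le> c \<bullet> a"
proof (rule ccontr)
  assume "\<not> ?thesis"
  then have "A \<subseteq> {y. c \<bullet> y < c \<bullet> x}" by auto
  then have "convex hull A \<subseteq> {y. c \<bullet> y < c \<bullet> x}" by (intro hull_minimal convex_halfspace_lt)
  with assms show False by auto
qed

lemma inner_eset: "eset S \<bullet> eset B = real (card (S \<inter> B)) - real (card (bar ` S \<inter> B))"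
proof -
  have "eset S \<bullet> eset B = (\<Sum>a\<in>S. of_bool (a \<in> B) - of_bool (bar a \<in> B))"
    unfolding eset_def[of S] inner_sum_left
    by (intro sum.cong refl) (auto simp: evec_def inner_axis' eset_nth bar_def)
  also have "\<dots> = (\<Sum>a\<in>S. of_bool (a \<in> B)) - (\<Sum>a\<in>bar ` S. of_bool (a \<in> B))"
    by (subst sum.reindex) (auto simp: sum_subtractf inj_on_def bar_def prod_eq_iff)
  finally show ?thesis by (simp add: of_bool_def sum.If_cases)
qed

lemma admissible_disjoint_bar: "admissible S \<Longrightarrow> S \<inter> bar ` S = {}"
  unfolding admissible_def bar_def by (auto; metis (full_types))

lemma inj_on_fst_admissible: "admissible S \<Longrightarrow> inj_on fst S"
  unfolding admissible_def by (auto simp: inj_on_def; metis (full_types))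

text \<open>\<open>eset B\<close> is a vertex of the cube with coordinates 1 and -1, which contains
  every \<open>eset B'\<close>, so a basis \<open>B'\<close> reaching the value of \<open>B\<close>
  under the functional \<open>eset B\<close> has the same coordinates. These determine
  \<open>B'\<close>, as both or neither copy of \<open>i\<close> would give 0.\<close>

lemma feasible_is_basis:
  assumes env: "enveloping_matroid Bs F" and B: "B \<in> F" "admissible B" "card B = CARD('n)"
  shows "(B :: ('n::finite \<times> bool) set) \<in> Bs"
proof -
  have "convex hull (eset ` Bs) = convex hull (eset ` F)"
    using env by (simp add: enveloping_matroid_def env_matroid_polytope delta_polytope_def)
  then have "eset B \<in> convex hull (eset ` Bs)" using B(1) by (simp add: hull_inc)
  then obtain B' where B': "B' \<in> Bs" "eset B \<bullet> eset B \<le> eset B \<bullet> eset B'"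
    using convex_hull_exists_inner_ge[of "eset B" "eset ` Bs" "eset B"] by auto
  have "card (fst ` B) = card (UNIV :: 'n set)"
    using inj_on_fst_admissible[OF B(2)] B(3) by (simp add: card_image)
  then have "fst ` B = UNIV" by (intro card_subset_eq) auto
  then have "\<exists>b. (i, b) \<in> B" for i by (metis (no_types) UNIV_I imageE prod.collapse)
  then have one: "(i, False) \<in> B \<longleftrightarrow> (i, True) \<notin> B" for i
    using B(2) unfolding admissible_def by (metis (full_types))
  have "(\<Sum>i\<in>UNIV. eset B $ i * eset B $ i - eset B $ i * eset B' $ i) \<le> 0"
    using B'(2) by (simp add: inner_vec_def sum_subtractf)
  moreover have ge: "eset B $ i * eset B $ i - eset B $ i * eset B' $ i \<ge> 0" for i
    using one[of i] by (auto simp: eset_nth)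
  ultimately have eq: "eset B $ i * eset B $ i - eset B $ i * eset B' $ i = 0" for i
    using sum_nonneg_eq_0_iff[of UNIV "\<lambda>i. eset B $ i * eset B $ i - eset B $ i * eset B' $ i"]
      sum_nonneg[of UNIV "\<lambda>i. eset B $ i * eset B $ i - eset B $ i * eset B' $ i"] by auto
  then have "(i, b) \<in> B \<longleftrightarrow> (i, b) \<in> B'" for i b
    using one[of i] eq[of i] by (cases b) (auto simp: eset_nth of_bool_def split: if_splits)
  then have "B = B'" by auto
  with B' show ?thesis by simp
qed

text \<open>A basis containing \<open>S\<close> and meeting \<open>bar ` S\<close> as little as possible shows that the functional
  \<open>eset S\<close> reaches the value forcing every maximizing feasible set to contain \<open>S\<close>.\<close>

lemma independent_in_iff_basis:
  assumes D: "delta_matroid F" and env: "enveloping_matroid Bs F" and S: "admissible S"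
  shows "(\<exists>B\<in>F. S \<subseteq> B) \<longleftrightarrow> (\<exists>B\<in>Bs. S \<subseteq> B)"
proof
  assume "\<exists>B\<in>F. S \<subseteq> B"
  then show "\<exists>B\<in>Bs. S \<subseteq> B"
    using feasible_is_basis[OF env] D by (auto simp: delta_matroid_def)
next
  assume indS: "\<exists>B\<in>Bs. S \<subseteq> B"
  have M: "matroid_bases UNIV Bs" using env by (simp add: enveloping_matroid_def)
  interpret matroid_independence "\<lambda>S. \<exists>B\<in>Bs. S \<subseteq> B" by (rule matroid_independence_bases[OF M])
  have "finite F" "F \<noteq> {}" using D by (auto simp: delta_matroid_def)
  then have "Max ((\<lambda>B. eset S \<bullet> eset B) ` F) \<in> (\<lambda>B. eset S \<bullet> eset B) ` F" by (intro Max_in) auto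
  then obtain B0 where B0: "B0 \<in> F" and B0_max: "eset S \<bullet> eset B0 = Max ((\<lambda>B. eset S \<bullet> eset B) ` F)"
    by auto
  have max: "eset S \<bullet> eset B \<le> eset S \<bullet> eset B0" if "B \<in> F" for B
    unfolding B0_max using that by (intro Max_ge) auto
  have B0': "B0 \<in> Bs" using feasible_is_basis[OF env B0] D B0 by (auto simp: delta_matroid_def)
  \<comment> \<open>Extending \<open>S\<close> only by elements of \<open>B0\<close> outside its bar
    keeps the new set disjoint from the bar of \<open>S\<close>. Its size then leaves a basis
    \<open>B\<close> above it no room for more elements of that bar than \<open>B0\<close>
    has.\<close>
  obtain S' where S': "S \<subseteq> S'" "S' \<subseteq> S \<union> (B0 - bar ` S)" "\<exists>B\<in>Bs. S' \<subseteq> B" "card (B0 - bar ` S) \<le> card S'"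
    using augment_to_card[OF indS, of "B0 - bar ` S"] B0' by blast
  then obtain B where B: "B \<in> Bs" "S' \<subseteq> B" by blast
  have "convex hull (eset ` Bs) = convex hull (eset ` F)"
    using env by (simp add: enveloping_matroid_def env_matroid_polytope delta_polytope_def)
  then have "eset B \<in> convex hull (eset ` F)" using B(1) by (metis hull_inc imageI)
  then have le: "eset S \<bullet> eset B \<le> eset S \<bullet> eset B0"
    using convex_hull_exists_inner_ge[of "eset B" "eset ` F" "eset S"] max by force
  have "card (bar ` S \<inter> B) + card S' = card (bar ` S \<inter> B \<union> S')"
    using S' admissible_disjoint_bar[OF S] by (intro card_Un_disjoint[symmetric]) auto
  also have "\<dots> \<le> card B" using B by (intro card_mono) auto
  also have "card B = card B0" by (rule matroid_bases_card_eq[OF M B(1) B0'])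
  also have "card B0 = card (B0 - bar ` S) + card (bar ` S \<inter> B0)"
    by (metis Int_commute add.commute card_Int_Diff finite)
  finally have "card (bar ` S \<inter> B) \<le> card (bar ` S \<inter> B0)" using S' by linarith
  moreover have "S \<inter> B = S" using S' B by auto
  ultimately have "card S \<le> card (S \<inter> B0)" using le by (simp add: inner_eset)
  then have "S \<inter> B0 = S" by (intro card_seteq) auto
  then show "\<exists>B\<in>F. S \<subseteq> B" using B0 by blast
qed

section \<open>Strictly Lorentzian approximations\<close>

text \<open>Turns an exponent vector into an argument list for the polarization; the chosen order is
  harmless because \<open>polar\<close> is symmetric.\<close>

definition expand :: "('v::finite \<Rightarrow> nat) \<Rightarrow> 'v list" where
  "expand \<beta> = (SOME xs. \<forall>v. count (mset xs) v = \<beta> v)"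

lemma count_expand: "count (mset (expand \<beta>)) v = \<beta> v"
proof -
  obtain xs where "mset xs = (\<Sum>v\<in>UNIV. replicate_mset (\<beta> v) v)" by (metis ex_mset)
  then have "\<forall>v. count (mset xs) v = \<beta> v" by (simp add: count_sum)
  then have "\<forall>v. count (mset (expand \<beta>)) v = \<beta> v" unfolding expand_def by (rule someI)
  then show ?thesis by simp
qed

lemma mset_expand_count: "mset (expand (count (mset xs))) = mset xs"
  by (simp add: multiset_eq_iff count_expand)

lemma mdeg_count: "mdeg (count (mset xs)) = length xs"
proof -
  have "mdeg (count (mset xs)) = (\<Sum>v\<in>set xs. count (mset xs) v)"
    unfolding mdeg_def by (intro sum.mono_neutral_right) (auto simp: not_in_iff[symmetric])
  then show ?thesis by (simp add: size_multiset_overloaded_eq[symmetric] flip: size_mset set_mset_mset)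
qed

section \<open>Derivatives of normalized coefficient functions\<close>

lemma prod_fun_upd:
  fixes f :: "'v::finite \<Rightarrow> nat \<Rightarrow> real"
  assumes "f i x = c * f i (\<beta> i)"
  shows "(\<Prod>v\<in>UNIV. f v ((\<beta>(i := x)) v)) = c * (\<Prod>v\<in>UNIV. f v (\<beta> v))"
proof -
  have "(\<Prod>v\<in>UNIV. f v ((\<beta>(i := x)) v)) = f i x * (\<Prod>v\<in>UNIV - {i}. f v ((\<beta>(i := x)) v))"
    by (subst prod.remove[of _ i]) auto
  also have "(\<Prod>v\<in>UNIV - {i}. f v ((\<beta>(i := x)) v)) = (\<Prod>v\<in>UNIV - {i}. f v (\<beta> v))"
    by (rule prod.cong) auto
  also have "f i x * \<dots> = c * (\<Prod>v\<in>UNIV. f v (\<beta> v))"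
    by (subst prod.remove[of UNIV i]) (auto simp: assms)
  finally show ?thesis .
qed

text \<open>The factorials absorb the factors produced by \<open>pdiff\<close>, so derivatives only
  shift exponents and Hessian entries become plain values of \<open>G\<close>.\<close>

lemma pdiffs_normalized:
  fixes "is" :: "'v::finite list"
  shows "pdiffs is (\<lambda>\<beta>. G \<beta> / (\<Prod>v\<in>UNIV. fact (\<beta> v)))
   = (\<lambda>\<alpha>. G (\<lambda>v. \<alpha> v + count (mset is) v) / (\<Prod>v\<in>UNIV. fact (\<alpha> v)))"
proof (induction "is")
  case Nil
  then show ?case by (simp add: pdiffs_def)
next
  case (Cons i "is")
  show ?case
  proof
    fix \<alpha> :: "'v \<Rightarrow> nat"
    let ?\<alpha> = "\<alpha>(i := \<alpha> i + 1)"
    have "(\<Prod>v\<in>UNIV. fact (?\<alpha> v) :: real) = real (\<alpha> i + 1) * (\<Prod>v\<in>UNIV. fact (\<alpha> v))"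
      using prod_fun_upd[of "\<lambda>_. fact" i "\<alpha> i + 1" "real (\<alpha> i + 1)" \<alpha>] by simp
    moreover have "(\<lambda>v. ?\<alpha> v + count (mset is) v) = (\<lambda>v. \<alpha> v + count (mset (i # is)) v)"
      by auto
    ultimately show "pdiffs (i # is) (\<lambda>\<beta>. G \<beta> / (\<Prod>v\<in>UNIV. fact (\<beta> v))) \<alpha>
      = G (\<lambda>v. \<alpha> v + count (mset (i # is)) v) / (\<Prod>v\<in>UNIV. fact (\<alpha> v))"
      using Cons by (simp add: pdiffs_def pdiff_def)
  qed
qed

lemma quad_matrix_normalized:
  "quad_matrix (pdiffs is (\<lambda>\<beta>. G \<beta> / (\<Prod>v\<in>UNIV. fact (\<beta> v)))) $ i $ j = G (count (mset (i # j # is)))"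
proof -
  have "quad_matrix (pdiffs is f) $ i $ j = pdiffs (i # j # is) f (\<lambda>_. 0)" for f :: "'a mpoly_coeffs"
    by (simp add: quad_matrix_def pdiffs_def)
  note eq = this
  show ?thesis by (subst eq) (simp only: pdiffs_normalized add_0 fact_0 prod.neutral_const div_by_1)
qed

text \<open>Damping the coefficients by \<open>t v ^ (\<beta> v choose 2)\<close> multiplies, up to a congruence by a positive
  diagonal matrix, only the diagonals of the Hessians by \<open>t\<close>; this is what makes weakly hyperbolic Hessians
  strict, and in the limit \<open>t v = 0\<close> it removes the monomials which are not squarefree in \<open>v\<close>.\<close>

definition damp :: "('v::finite \<Rightarrow> real) \<Rightarrow> ('v \<Rightarrow> nat) \<Rightarrow> real" where
  "damp t \<beta> = (\<Prod>v\<in>UNIV. t v ^ (\<beta> v choose 2))"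

text \<open>The exponent \<open>k choose 2\<close> grows by \<open>k\<close> when \<open>k\<close>
  grows by 1.\<close>

lemma damp_add_one: "damp t (\<beta>(i := Suc (\<beta> i))) = damp t \<beta> * t i ^ \<beta> i"
  unfolding damp_def
  by (subst prod_fun_upd[where c = "t i ^ \<beta> i"]) (auto simp: numeral_2_eq_2 power_add)

lemma damp_count_Cons2:
  "damp t (count (mset (i # j # is))) = damp t (count (mset is)) *
     (t i ^ count (mset is) i * t j ^ count (mset is) j) * (if i = j then t i else 1)"
proof -
  have "count (mset (k # xs)) = (count (mset xs))(k := Suc (count (mset xs) k))" for k and xs :: "'a list"
    by auto
  then show ?thesis by (simp only: damp_add_one) (auto simp: ac_simps)
qed

lemma damp_pos: "(\<And>v. t v > 0) \<Longrightarrow> damp t \<beta> > 0"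
  unfolding damp_def by (intro prod_pos) auto

section \<open>The approximating polynomials\<close>

context matroid_independence
begin

text \<open>With \<open>t = 1\<close> throughout, this is the polynomial in \<open>y\<close>
  obtained from \<open>polar\<close> at \<open>d\<close> copies of the sum of the
  \<open>y v *\<^sub>R w v\<close>, divided by \<open>fact d\<close>.\<close>

definition polar_poly :: "nat \<Rightarrow> ('v::finite \<Rightarrow> real) \<Rightarrow> ('v \<Rightarrow> real^'e option) \<Rightarrow> 'v mpoly_coeffs" where
  "polar_poly d t w = (\<lambda>\<beta>. (if mdeg \<beta> = d then damp t \<beta> * polar (map w (expand \<beta>)) {} else 0)
     / (\<Prod>v\<in>UNIV. fact (\<beta> v)))"

lemma polar_map_mset: "mset xs = mset ys \<Longrightarrow> polar (map w xs) I = polar (map w ys) I"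
  by (rule polar_mset) simp

text \<open>Up to a positive factor and a diagonal congruence, each Hessian is the Gram matrix of
  the vectors \<open>w i\<close> under a hyperbolic form, with diagonal multiplied by
  \<open>t i < 1\<close>. This subtracts a positive definite diagonal matrix, so strictness holds
  even for linearly dependent \<open>w i\<close>.\<close>

lemma strictly_lorentzian_polar_poly:
  assumes w: "\<And>v u. w v $ u > 0" and t: "\<And>v. 0 < t v" "\<And>v. t v < 1" and d: "d \<ge> 2"
    and empty: "indep {}"
  shows "strictly_lorentzian d (polar_poly d t w)"
  unfolding strictly_lorentzian_def
proof (intro conjI allI impI)
  have pos: "polar (map w xs) I > 0" for xs I by (rule polar_pos) (auto simp: w)
  show "homogeneous d (polar_poly d t w)"
    by (simp add: homogeneous_def polar_poly_def)
  show "polar_poly d t w \<alpha> > 0" if "mdeg \<alpha> = d" for \<alpha>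
    using that pos damp_pos[of t \<alpha>, OF t(1)] by (auto simp: polar_poly_def intro!: divide_pos_pos prod_pos)
  fix "is" :: "'a list" assume len: "length is = d - 2"
  define A where "A = quad_matrix (pdiffs is (polar_poly d t w))"
  define s where "s i = t i ^ count (mset is) i" for i
  define D where "D = damp t (count (mset is))"
  define p where "p = (\<lambda>x y. polar (x # y # map w is) {})"
  have D: "D > 0" unfolding D_def using t(1) by (rule damp_pos)
  have s: "s i > 0" for i using t(1) by (simp add: s_def)
  have pb: "bilinear p" unfolding p_def by (rule bilinear_polar)
  have psym: "p x y = p y x" for x y unfolding p_def by (rule polar_swap)
  have pw: "p (w i) (w j) > 0" for i j using pos[of "i # j # is"] by (simp add: p_def)
  have A: "A $ i $ j = D * (s i * s j) * (if i = j then t i else 1) * p (w i) (w j)" for i j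
  proof -
    have "A $ i $ j = damp t (count (mset (i # j # is))) * polar (map w (expand (count (mset (i # j # is))))) {}"
      unfolding A_def polar_poly_def quad_matrix_normalized mdeg_count using len d by simp
    also have "polar (map w (expand (count (mset (i # j # is))))) {} = p (w i) (w j)"
      using polar_map_mset[OF mset_expand_count[of "i # j # is"], of w "{}"] by (simp add: p_def)
    finally show ?thesis by (simp only: damp_count_Cons2 s_def D_def)
  qed
  have quad: "y \<bullet> (A *v y) = (\<Sum>i\<in>UNIV. \<Sum>j\<in>UNIV. y $ i * A $ i $ j * y $ j)" for y
    by (simp add: inner_vec_def matrix_vector_mult_def sum_distrib_left mult.assoc)
  have sym: "transpose A = A"
  proof -
    have "A $ j $ i = A $ i $ j" for i j
      unfolding A using psym[of "w i" "w j"] by (auto simp: mult_ac)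
    then show ?thesis by (simp add: vec_eq_iff transpose_def)
  qed
  have pos1: "(\<chi> i. 1) \<bullet> (A *v (\<chi> i. 1)) > 0"
    unfolding quad using D s t(1) pw by (auto intro!: sum_pos mult_pos_pos simp: A)
  \<comment> \<open>Any strictly positive reference vector would do; orthogonality in
    \<open>neg\<close> is chosen to say \<open>p e Y = 0\<close>.\<close>
  define e :: "real^'e option" where "e = (\<chi> u. 1)"
  have neg: "y \<bullet> (A *v y) < 0" if y: "(\<chi> i. s i * p e (w i)) \<bullet> y = 0" "y \<noteq> 0" for y
  proof -
    define Y where "Y = (\<Sum>i\<in>UNIV. (s i * y $ i) *\<^sub>R w i)"
    have "p e Y = (\<Sum>i\<in>UNIV. (s i * y $ i) * p e (w i))"
      using pb unfolding Y_def bilinear_def by (simp add: linear_sum linear_scale)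
    also have "\<dots> = 0" using y(1) by (simp add: inner_vec_def ac_simps)
    finally have "p Y Y \<le> 0"
      unfolding p_def by (rule polar_hyperbolic[OF empty, rotated 2]) (auto simp: e_def w)
    have "p Y Y = (\<Sum>i\<in>UNIV. \<Sum>j\<in>UNIV. (s i * y $ i) * (s j * y $ j) * p (w i) (w j))"
      unfolding Y_def bilinear_sum[OF pb] sum.cartesian_product[symmetric]
      by (simp add: bilinear_lmul[OF pb] bilinear_rmul[OF pb] ac_simps)
    moreover have "y \<bullet> (A *v y) = (\<Sum>i\<in>UNIV. \<Sum>j\<in>UNIV. D * ((s i * y $ i) * (s j * y $ j) * p (w i) (w j))
       - (if i = j then D * (1 - t i) * (s i * y $ i)\<^sup>2 * p (w i) (w i) else 0))"
      unfolding quad by (intro sum.cong refl) (auto simp: A power2_eq_square algebra_simps)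
    ultimately have eq: "y \<bullet> (A *v y) = D * p Y Y - (\<Sum>i\<in>UNIV. D * (1 - t i) * (s i * y $ i)\<^sup>2 * p (w i) (w i))"
      by (simp add: sum_subtractf sum_distrib_left)
    obtain i where i: "y $ i \<noteq> 0" using y(2) by (auto simp: vec_eq_iff)
    have "(\<Sum>i\<in>UNIV. D * (1 - t i) * (s i * y $ i)\<^sup>2 * p (w i) (w i)) > 0"
    proof (rule sum_pos2[of _ i])
      show "D * (1 - t i) * (s i * y $ i)\<^sup>2 * p (w i) (w i) > 0"
        using D t(2)[of i] s[of i] i pw by (intro mult_pos_pos) (auto simp: less_le)
      show "D * (1 - t i) * (s i * y $ i)\<^sup>2 * p (w i) (w i) \<ge> 0" for i
        using D t(2)[of i] pw[of i i] by (intro mult_nonneg_nonneg) auto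
    qed auto
    moreover have "D * p Y Y \<le> 0" using D \<open>p Y Y \<le> 0\<close> by (simp add: mult_le_0_iff)
    ultimately show ?thesis using eq by linarith
  qed
  show "det (quad_matrix (pdiffs is (polar_poly d t w))) \<noteq> 0"
    using hyperbolic_matrix_eigenvalues(1)[OF sym pos1 neg] by (simp add: A_def)
  show "num_pos_eigenvalues (quad_matrix (pdiffs is (polar_poly d t w))) = 1"
    using hyperbolic_matrix_eigenvalues(2)[OF sym pos1 neg] by (simp add: A_def)
qed

lemma tendsto_polar:
  assumes "\<And>v u. ((\<lambda>k. w k v $ u) \<longlongrightarrow> w' v $ u) F"
  shows "((\<lambda>k. polar (map (w k) xs) I) \<longlongrightarrow> polar (map w' xs) I) F"
  by (induction xs arbitrary: I) (auto simp: polar.simps(2) intro!: tendsto_intros assms)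

lemma lorentzian_polar_poly:
  assumes w: "\<And>v u. w v $ u \<ge> 0" and t: "\<And>v. 0 \<le> t v" "\<And>v. t v \<le> 1" and d: "d \<ge> 2"
    and empty: "indep {}"
  shows "lorentzian d (polar_poly d t w)"
proof -
  define \<epsilon> where "\<epsilon> k = 1 / (real k + 3)" for k :: nat
  have \<epsilon>: "0 < \<epsilon> k" "\<epsilon> k < 1 / 2" for k by (auto simp: \<epsilon>_def field_simps)
  have \<epsilon>0: "\<epsilon> \<longlonglongrightarrow> 0"
  proof -
    have "(\<lambda>k. 1 / real (k + 3)) \<longlonglongrightarrow> 0"
      by (rule LIMSEQ_ignore_initial_segment[OF lim_1_over_n])
    then show ?thesis by (simp add: \<epsilon>_def[abs_def] add.commute)
  qed
  \<comment> \<open>Maps the interval from 0 to 1 into the one from \<open>\<epsilon> k\<close> to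
    \<open>1 - \<epsilon> k\<close>, which lies strictly inside.\<close>
  define t' where "t' k v = (1 - 2 * \<epsilon> k) * t v + \<epsilon> k" for k v
  define w' where "w' k v = (\<chi> u. w v $ u + \<epsilon> k)" for k v
  have t'_pos: "0 < t' k v" for k v
    using \<epsilon>[of k] t(1)[of v] by (auto simp: t'_def intro!: add_nonneg_pos mult_nonneg_nonneg)
  have t'_less: "t' k v < 1" for k v
  proof -
    define c where "c = 1 - 2 * \<epsilon> k"
    have "c * t v \<le> c"
      using \<epsilon>[of k] mult_left_mono[OF t(2)[of v], of c] by (simp add: c_def)
    moreover have "c + \<epsilon> k < 1" using \<epsilon>[of k] by (simp add: c_def)
    ultimately show ?thesis by (simp add: t'_def c_def[symmetric])
  qed
  have "(\<lambda>k. t' k v) \<longlonglongrightarrow> (1 - 2 * 0) * t v + 0" for v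
    unfolding t'_def by (intro tendsto_intros \<epsilon>0)
  then have t'_lim: "(\<lambda>k. t' k v) \<longlonglongrightarrow> t v" for v by simp
  have "(\<lambda>k. w' k v $ u) \<longlonglongrightarrow> w v $ u + 0" for v u
    unfolding w'_def by (simp del: add_0_right) (intro tendsto_intros \<epsilon>0)
  then have w'_lim: "(\<lambda>k. w' k v $ u) \<longlonglongrightarrow> w v $ u" for v u by simp
  have "strictly_lorentzian d (polar_poly d (t' k) (w' k))" for k
    using w \<epsilon>(1) by (intro strictly_lorentzian_polar_poly t'_pos t'_less d empty)
      (auto simp: w'_def intro: add_nonneg_pos)
  moreover have "(\<lambda>k. polar_poly d (t' k) (w' k) \<beta>) \<longlonglongrightarrow> polar_poly d t w \<beta>" for \<beta>
    unfolding polar_poly_def damp_def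
    by (cases "mdeg \<beta> = d") (auto intro!: tendsto_divide tendsto_mult tendsto_prod tendsto_power
      tendsto_const t'_lim tendsto_polar w'_lim simp: prod_eq_1_iff)
  ultimately show ?thesis
    unfolding lorentzian_def by (intro exI[of _ "\<lambda>k. polar_poly d (t' k) (w' k)"] conjI allI)
qed

end

section \<open>The independence polynomial of a delta-matroid\<close>

context matroid_independence
begin

lemma polar_replicate_None: "polar (replicate k (axis None 1)) I = fact (CARD('e) - card I)"
  by (induction k) (simp_all add: polar_axis slot_def)

end

text \<open>The direction of \<open>w_i\<close> once both copies of \<open>i\<close> are
  identified.\<close>

definition identify :: "'n::finite option \<Rightarrow> real^('n \<times> bool) option" where
  "identify v = (case v of None \<Rightarrow> axis None 1
     | Some i \<Rightarrow> axis (Some (i, False)) 1 + axis (Some (i, True)) 1)"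

text \<open>Each \<open>i\<close> in the list branches into its two copies, so the recursion
  enumerates the signed lifts of \<open>set is\<close>. The number \<open>k\<close> does not matter,
  as arguments \<open>axis None 1\<close> change nothing.\<close>

lemma polar_identify:
  fixes indep :: "('n::finite \<times> bool) set \<Rightarrow> bool" and "is" :: "'n list"
  assumes "matroid_independence indep" and "distinct is" and "set is \<inter> fst ` I = {}" and "indep I"
  shows "matroid_independence.polar indep (map identify (map Some is @ replicate k None)) I
    = fact (CARD('n \<times> bool) - card I - length is)
      * card {S. admissible S \<and> fst ` S = set is \<and> indep (I \<union> S)}"
proof -
  interpret matroid_independence indep by (rule assms)
  show ?thesis
    using assms(2-4)
  proof (induction "is" arbitrary: I)
    case Nil
    have "{S. admissible S \<and> fst ` S = set [] \<and> indep (I \<union> S)} = {{}}"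
      using Nil by (auto simp: admissible_def)
    then show ?case by (simp add: identify_def polar_replicate_None)
  next
    case (Cons i "is")
    define T where "T J = {S. admissible S \<and> fst ` S = set is \<and> indep (J \<union> S)}" for J
    define xs where "xs = map identify (map Some is @ replicate k None)"
    have i: "i \<notin> fst ` I" "i \<notin> set is" using Cons.prems by auto
    have fst_T: "i \<notin> fst ` S" if "S \<in> T J" for S J using that i by (auto simp: T_def)
    \<comment> \<open>Choosing a copy of \<open>i\<close> moves one element from the list to
      \<open>I\<close>, so the factorial is the same in both branches.\<close>
    have Suc: "CARD('n \<times> bool) - card (insert (i, b) I) - length is = CARD('n \<times> bool) - card I - length (i # is)"
      for b using i by (subst card_insert_disjoint) (auto simp: image_iff)
    have slot: "slot (Some (i, b)) xs I
        = fact (CARD('n \<times> bool) - card I - length (i # is)) * card (T (insert (i, b) I))" for b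
    proof (cases "indep (insert (i, b) I)")
      case True
      have "set is \<inter> fst ` insert (i, b) I = {}" using Cons.prems by auto
      then have "polar xs (insert (i, b) I) = fact (CARD('n \<times> bool) - card (insert (i, b) I) - length is)
         * card (T (insert (i, b) I))"
        using Cons.IH[of "insert (i, b) I"] Cons.prems True by (simp add: xs_def T_def)
      moreover have "(i, b) \<in> ext I" using True i by (force simp: ext_def)
      ultimately show ?thesis by (simp only: slot_def option.case if_True Suc)
    next
      case False
      then have "T (insert (i, b) I) = {}"
        using indep_subset[of "insert (i, b) I \<union> _" "insert (i, b) I"] by (auto simp: T_def)
      moreover have "(i, b) \<notin> ext I" using False by (simp add: ext_def)
      ultimately show ?thesis by (simp add: slot_def)
    qed
    \<comment> \<open>The sets are split by which copy of \<open>i\<close> they contain.\<close>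
    have "{S. admissible S \<and> fst ` S = set (i # is) \<and> indep (I \<union> S)}
      = insert (i, False) ` T (insert (i, False) I) \<union> insert (i, True) ` T (insert (i, True) I)"
      (is "?L = ?R")
    proof (intro antisym subsetI)
      fix S assume "S \<in> ?L"
      then have S: "admissible S" "fst ` S = insert i (set is)" "indep (I \<union> S)" by auto
      then obtain b where b: "(i, b) \<in> S" by (metis imageE insertI1 prod.collapse)
      have "S - {(i, b)} \<in> T (insert (i, b) I)"
      proof -
        have "admissible (S - {(i, b)})" using S(1) by (auto simp: admissible_def)
        moreover have "fst ` (S - {(i, b)}) = fst ` S - fst ` {(i, b)}"
          using inj_on_image_set_diff[OF inj_on_fst_admissible[OF S(1)], of S "{(i, b)}"] b by simp
        moreover have "insert (i, b) I \<union> (S - {(i, b)}) = I \<union> S" using b by auto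
        ultimately show ?thesis using S i by (auto simp: T_def)
      qed
      then have "S \<in> insert (i, b) ` T (insert (i, b) I)" using b by (intro image_eqI[of _ _ "S - {(i, b)}"]) auto
      then show "S \<in> ?R" by (cases b) auto
    next
      fix S assume "S \<in> ?R"
      then obtain b S' where S': "S = insert (i, b) S'" "S' \<in> T (insert (i, b) I)" by blast
      have "i \<notin> fst ` S'" by (rule fst_T[OF S'(2)])
      then have "admissible S" using S' by (auto simp: admissible_def T_def image_iff)
      then show "S \<in> ?L" using S' by (auto simp: T_def)
    qed
    moreover have "insert (i, False) ` T (insert (i, False) I) \<inter> insert (i, True) ` T (insert (i, True) I) = {}"
    proof -
      have False if "S1 \<in> T J" "insert (i, False) S1 = insert (i, True) S2" for S1 S2 J
      proof -
        have "(i, True) \<in> S1" using that(2) by blast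
        then have "i \<in> fst ` S1" by force
        with fst_T[OF that(1)] show False by blast
      qed
      then show ?thesis by blast
    qed
    moreover have "card (insert (i, b) ` T J) = card (T J)" for b J
    proof (rule card_image, rule inj_onI)
      fix S S' assume S: "S \<in> T J" "S' \<in> T J" and eq: "insert (i, b) S = insert (i, b) S'"
      have "(i, b) \<notin> S" "(i, b) \<notin> S'" using fst_T[OF S(1)] fst_T[OF S(2)] by force+
      then show "S = S'" using eq by (simp add: insert_ident)
    qed
    ultimately have card: "card {S. admissible S \<and> fst ` S = set (i # is) \<and> indep (I \<union> S)}
      = card (T (insert (i, False) I)) + card (T (insert (i, True) I))"
      by (simp add: card_Un_disjoint)
    have "polar (map identify (map Some (i # is) @ replicate k None)) I = polar (identify (Some i) # xs) I"
      by (simp add: xs_def)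
    also have "\<dots> = slot (Some (i, False)) xs I + slot (Some (i, True)) xs I"
      by (simp only: polar_Cons_slot)
        (simp add: identify_def axis_def distrib_right sum.distrib if_distrib[of "\<lambda>u. u * _"] cong: if_cong)
    finally show ?case by (simp only: slot card) (simp add: distrib_left)
  qed
qed

theorem theorem3p14:
  fixes F :: "('n::finite \<times> bool) set set"
  assumes "delta_matroid F"
    and "\<exists>Bs. enveloping_matroid Bs F"
  shows "lorentzian (2 * CARD('n)) (indep_poly F)"
proof -
  obtain Bs where Bs: "enveloping_matroid Bs F" using assms(2) by blast
  define indep where "indep S \<longleftrightarrow> (\<exists>B\<in>Bs. S \<subseteq> B)" for S
  have M: "matroid_independence indep"
    unfolding indep_def using Bs by (intro matroid_independence_bases) (simp add: enveloping_matroid_def)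
  interpret matroid_independence indep by (rule M)
  have ind: "independent_in F S \<longleftrightarrow> admissible S \<and> indep S" for S
    using independent_in_iff_basis[OF assms(1) Bs] by (auto simp: independent_in_def indep_def)
  have empty: "indep {}"
    using Bs by (auto simp: indep_def enveloping_matroid_def matroid_bases_def)
  \<comment> \<open>The value 1 keeps all powers of \<open>w_0\<close>; the value 0 deletes
    monomials with a repeated \<open>w_i\<close>, which come from independent sets containing both
    copies of \<open>i\<close>.\<close>
  define t :: "'n option \<Rightarrow> real" where "t v = (case v of None \<Rightarrow> 1 | Some _ \<Rightarrow> 0)" for v
  have d: "2 \<le> 2 * CARD('n)" using one_le_card_finite[where 'a = 'n] by linarith
  have mdeg_option: "mdeg \<beta> = \<beta> None + (\<Sum>i\<in>UNIV. \<beta> (Some i))" for \<beta> :: "'n option \<Rightarrow> nat"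
    by (simp add: mdeg_def UNIV_option_conv sum.reindex)
  have prod_option: "(\<Prod>v\<in>UNIV. f v) = f None * (\<Prod>i\<in>UNIV. f (Some i))" for f :: "'n option \<Rightarrow> real"
    by (simp add: UNIV_option_conv prod.reindex)
  have card_adm: "card (fst ` S) = card S" if "admissible S" for S :: "('n \<times> bool) set"
    using inj_on_fst_admissible[OF that] by (rule card_image)
  have "indep_poly F \<beta> = polar_poly (2 * CARD('n)) t identify \<beta>" for \<beta>
  proof (cases "mdeg \<beta> = 2 * CARD('n) \<and> (\<forall>i. \<beta> (Some i) \<le> 1)")
    case True
    define T where "T = {i. \<beta> (Some i) = 1}"
    obtain "is" where "is": "set is = T" "distinct is" using finite_distinct_list[of T] by auto
    have \<beta>_Some: "\<beta> (Some i) = (if i \<in> T then 1 else 0)" for i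
      using True spec[of "\<lambda>i. \<beta> (Some i) \<le> 1" i] by (auto simp: T_def le_Suc_eq)
    have \<beta>_None: "\<beta> None = 2 * CARD('n) - card T"
    proof -
      have "\<beta> None + card T = 2 * CARD('n)"
        using True by (simp add: mdeg_option \<beta>_Some sum.If_cases)
      then show ?thesis by linarith
    qed
    have damp: "damp t \<beta> = 1"
      by (auto simp: damp_def prod_option t_def \<beta>_Some numeral_2_eq_2 intro!: prod.neutral)
    have "count (mset (map Some is @ replicate (\<beta> None) None)) v = \<beta> v" for v
    proof -
      have "distinct (map Some is)" using "is"(2) by (simp add: distinct_map)
      then have "count (mset (map Some is)) v = (if v \<in> Some ` T then 1 else 0)"
        using "is"(1) distinct_count_atmost_1[of "map Some is"] by simp
      then show ?thesis by (cases v) (auto simp: \<beta>_Some)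
    qed
    then have "mset (expand \<beta>) = mset (map Some is @ replicate (\<beta> None) None)"
      by (simp add: multiset_eq_iff count_expand)
    then have "polar (map identify (expand \<beta>)) {}
       = polar (map identify (map Some is @ replicate (\<beta> None) None)) {}"
      by (rule polar_map_mset)
    also have "\<dots> = fact (\<beta> None) * card {S. admissible S \<and> fst ` S = T \<and> indep S}"
      using polar_identify[OF M "is"(2), of "{}"] empty "is" distinct_card[OF "is"(2)]
      by (simp add: \<beta>_None mult.commute[of _ 2])
    finally have pol: "polar (map identify (expand \<beta>)) {}
       = fact (\<beta> None) * card {S. admissible S \<and> fst ` S = T \<and> indep S}" .
    have "indep_monomial S = \<beta> \<longleftrightarrow> fst ` S = T" if "admissible S" for S
    proof
      assume eq: "indep_monomial S = \<beta>"
      have "\<beta> (Some i) = (if i \<in> fst ` S then 1 else 0)" for i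
        unfolding eq[symmetric] by (simp add: indep_monomial_def)
      then have "i \<in> T \<longleftrightarrow> i \<in> fst ` S" for i by (simp add: T_def)
      then show "fst ` S = T" by blast
    next
      assume "fst ` S = T"
      then have "indep_monomial S v = \<beta> v" for v
        using card_adm[OF that] by (cases v) (auto simp: indep_monomial_def \<beta>_None \<beta>_Some)
      then show "indep_monomial S = \<beta>" by auto
    qed
    then have "{S. independent_in F S \<and> indep_monomial S = \<beta>} = {S. admissible S \<and> fst ` S = T \<and> indep S}"
      by (auto simp: ind)
    \<comment> \<open>The factorial of the \<open>w_0\<close> exponent is the only one that need not
      be 1, and it cancels the factor in \<open>pol\<close>.\<close>
    moreover have "(\<Prod>v\<in>UNIV. fact (\<beta> v) :: real) = fact (\<beta> None)"
      by (auto simp: prod_option \<beta>_Some intro!: prod.neutral)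
    ultimately show ?thesis using True by (simp add: indep_poly_def polar_poly_def damp pol)
  next
    case False
    have "mdeg (indep_monomial S) = 2 * CARD('n)" "indep_monomial S (Some i) \<le> 1"
      if "admissible S" for S :: "('n \<times> bool) set" and i
    proof -
      \<comment> \<open>Ensures that the truncated exponent \<open>2 * CARD('n) - card S\<close> is
        exact.\<close>
      have "card S \<le> CARD('n \<times> bool)" by (rule card_mono) auto
      then show "mdeg (indep_monomial S) = 2 * CARD('n)"
        using card_adm[OF that] by (simp add: mdeg_option indep_monomial_def sum.If_cases)
    qed (simp add: indep_monomial_def)
    then have "{S. independent_in F S \<and> indep_monomial S = \<beta>} = {}"
      using False by (auto simp: ind)
    then have "indep_poly F \<beta> = 0" by (simp only: indep_poly_def card.empty of_nat_0)
    moreover have "polar_poly (2 * CARD('n)) t identify \<beta> = 0"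
    proof (cases "mdeg \<beta> = 2 * CARD('n)")
      case True
      with False obtain i where "\<not> \<beta> (Some i) \<le> 1" by blast
      then have "2 \<le> \<beta> (Some i)" by simp
      then have "t (Some i) ^ (\<beta> (Some i) choose 2) = 0" by (simp add: t_def zero_less_binomial)
      then have "damp t \<beta> = 0" unfolding damp_def by (intro prod_zero) auto
      then show ?thesis by (simp add: polar_poly_def)
    qed (simp add: polar_poly_def)
    ultimately show ?thesis by simp
  qed
  then have "indep_poly F = polar_poly (2 * CARD('n)) t identify" by blast
  moreover have "lorentzian (2 * CARD('n)) (polar_poly (2 * CARD('n)) t identify)"
    by (rule lorentzian_polar_poly)
      (auto simp: identify_def t_def axis_def d empty split: option.splits)
  ultimately show ?thesis by simp
qed

end
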